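(* Let $R=K[x_1,\dots,x_n]$ be a polynomial ring over a field $K$, let $0\ne\lambda=(\lambda_1,\dots,\lambda_n)\in P_n$, $I=\mathrm{Sss}(\{\lambda\})$, $j'=\min\{i:\lambda_i>0\}$, $P_j=(x_1,\dots,x_j)$ and $a_j=\sum_{i=1}^j\lambda_i$ for $1\le j\le n$. For a fixed $k\ge1$ consider the decomposition $$I^k=\bigcap_{j=1}^nI_{n,j}^{(ka_j)}.\qquad( * )$$ Then: (1) all components $I_{n,j}^{(ka_j)}$ with $j<j'$ are redundant in $( * )$; (2) $I_{n,j'}^{(ka_{j'})}$ is not redundant in $( * )$ and moreover $I^{(k)_{\mathrm{Min}}}=I_{n,j'}^{(k\lambda_{j'})}$; (3) if $j>j'$ and $\lambda_{j-1}<\lambda_j$, then the component $I_{n,j}^{(ka_j)}$ is not redundant in $( * )$; (4) if $\lambda_1<\lambda_j$ and either $k>j(j-1)$ or $\lambda_j>\frac{q+j-r}{k}$, where $k\sum_{i=1}^{j-1}\lambda_i=(j-1)q+r$ with integers $q$ and $0\le r\le j-2$, then the component $I_{n,j}^{(ka_j)}$ is not redundant in $( * )$ if and only if $j\ge j'$; (5) if $\lambda_1=\lambda_j$ for some $j>1$, then the component $I_{n,j}^{(ka_j)}$ is redundant in $( * )$. In particular, for $k\gg0$ a minimal primary decomposition of $I^k$ is $$I^k=\bigcap_{j\in\mathcal I}\ \bigcap_{\sigma\in\mathfrak S_n}\sigma(P_j)^{ka_j},$$ where $\mathcal I=\{j: j\ge j'\}$ if $j'>1$ and $\mathcal I=\{1\}\cup\{j: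 j>1\text{ and }\lambda_j\ne\lambda_1\}$ if $j'=1$.
   Context: $\mathfrak S_n$ acts on $R$ by permuting variables. $P_n=\{\lambda\in\mathbb Z^n: 0\le\lambda_1\le\cdots\le\lambda_n\}$, $x^\lambda=x_1^{\lambda_1}\cdots x_n^{\lambda_n}$. For an $\mathfrak S_n$-fixed monomial ideal $I$ put $P(I)=\{\lambda\in P_n: x^\lambda\in I\}$. An $\mathfrak S_n$-fixed monomial ideal $I$ is symmetric strongly shifted if for every $\lambda\in P(I)$ and $1\le i<j\le n$ with $\lambda_i<\lambda_j$ one has $x^\lambda x_i/x_j\in I$. $\mathrm{Sss}(\{\lambda\})$ is the smallest symmetric strongly shifted ideal containing $x^\lambda$. $I_{n,j}=\bigcap_{1\le i_1<\cdots<i_j\le n}(x_{i_1},\dots,x_{i_j})$, and its symbolic power is $I_{n,j}^{(m)}=\bigcap_{1\le i_1<\cdots<i_j\le n}(x_{i_1},\dots,x_{i_j})^m=\bigcap_{\sigma\in\mathfrak S_n}\sigma(P_j)^m$ (equal to $R$ for $m=0$). The decomposition $( * )$ is known to hold. A component $I_{n,j}^{(ka_j)}$ is redundant in $( * )$ if $\bigcap_{i\ne j}I_{n,i}^{(ka_i)}\subseteq I_{n,j}^{(ka_j)}$. For an ideal $I$, $I^{(k)_{\mathrm{Min}}}=\bigcap_{P\in\mathrm{Min}(I)}(I^kR_P\cap R)$, where $\mathrm{Min}(I)$ is the set of minimal primes of $I$. In the final primary decomposition each ideal $\sigma(P_j)^{ka_j}$ is counted once (different $\sigma$ may give the same ideal).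 *)

theory Defs
  imports
    Complex_Main
    "HOL-Library.Poly_Mapping"
    "HOL-Computational_Algebra.Fraction_Field"
    "HOL-Combinatorics.Permutations"
    "HOL-Algebra.Ideal_Product"
begin

section \<open>The polynomial ring in n variables\<close>

text \<open>Polynomials are finitely supported functions from exponent vectors to coefficients, the
  product being the convolution product of \<^theory>\<open>HOL-Library.Poly_Mapping\<close>. The type has
  variables indexed by all natural numbers; the ring in n variables is the subring of polynomials
  in the variables with indices 1, ..., n.\<close>

type_synonym 'k mpoly = "(nat \<Rightarrow>\<^sub>0 nat) \<Rightarrow>\<^sub>0 'k"

definition subring_on :: "'a::comm_ring_1 set \<Rightarrow> 'a ring" where
  "subring_on C = \<lparr>carrier = C, mult = (*), one = 1, zero = 0, add = (+)\<rparr>"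

definition expvecs :: "nat \<Rightarrow> (nat \<Rightarrow>\<^sub>0 nat) set" where
  "expvecs n = {u. Poly_Mapping.keys u \<subseteq> {1..n}}"

definition poly_ring :: "nat \<Rightarrow> ('k::field) mpoly ring" where
  "poly_ring n = subring_on {p. Poly_Mapping.keys p \<subseteq> expvecs n}"

text \<open>\<open>xpow u\<close> is the monomial with exponent vector \<open>u\<close>.\<close>

definition xpow :: "(nat \<Rightarrow>\<^sub>0 nat) \<Rightarrow> ('k::field) mpoly" where
  "xpow u = Poly_Mapping.single u 1"

definition var :: "nat \<Rightarrow> ('k::field) mpoly" where
  "var i = xpow (Poly_Mapping.single i 1)"

text \<open>For a permutation \<open>\<sigma>\<close> this is the ring automorphism sending \<open>var i\<close> to \<open>var (\<sigma> i)\<close>: the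
  coefficient of \<open>perm_poly \<sigma> f\<close> at the exponent vector \<open>u\<close> is the one of \<open>f\<close> at \<open>u \<circ> \<sigma>\<close>
  (\<^const>\<open>Poly_Mapping.map_key\<close> is precomposition with an injective map).\<close>

definition perm_poly :: "(nat \<Rightarrow> nat) \<Rightarrow> ('k::field) mpoly \<Rightarrow> 'k mpoly" where
  "perm_poly \<sigma> = Poly_Mapping.map_key (Poly_Mapping.map_key \<sigma>)"


section \<open>Symmetric strongly shifted ideals\<close>

definition Pn :: "nat \<Rightarrow> (nat \<Rightarrow>\<^sub>0 nat) set" where
  "Pn n = {u \<in> expvecs n. \<forall>i j. 1 \<le> i \<and> i \<le> j \<and> j \<le> n \<longrightarrow>
             Poly_Mapping.lookup u i \<le> Poly_Mapping.lookup u j}"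

definition monomial_ideal :: "nat \<Rightarrow> ('k::field) mpoly set \<Rightarrow> bool" where
  "monomial_ideal n I \<longleftrightarrow> (\<exists>S \<subseteq> expvecs n. I = Idl\<^bsub>poly_ring n\<^esub> (xpow ` S))"

definition sym_monomial_ideal :: "nat \<Rightarrow> ('k::field) mpoly set \<Rightarrow> bool" where
  "sym_monomial_ideal n I \<longleftrightarrow>
     monomial_ideal n I \<and> (\<forall>\<sigma>. \<sigma> permutes {1..n} \<longrightarrow> perm_poly \<sigma> ` I = I)"

definition P_of :: "nat \<Rightarrow> ('k::field) mpoly set \<Rightarrow> (nat \<Rightarrow>\<^sub>0 nat) set" where
  "P_of n I = {u \<in> Pn n. xpow u \<in> I}"

definition sym_strongly_shifted :: "nat \<Rightarrow> ('k::field) mpoly set \<Rightarrow> bool" where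
  "sym_strongly_shifted n I \<longleftrightarrow>
     sym_monomial_ideal n I \<and>
     (\<forall>u \<in> P_of n I. \<forall>i j. 1 \<le> i \<and> i < j \<and> j \<le> n \<and>
        Poly_Mapping.lookup u i < Poly_Mapping.lookup u j \<longrightarrow>
        xpow (u + Poly_Mapping.single i 1 - Poly_Mapping.single j 1) \<in> I)"

definition Sss :: "nat \<Rightarrow> (nat \<Rightarrow>\<^sub>0 nat) set \<Rightarrow> ('k::field) mpoly set" where
  "Sss n B = \<Inter>{I. sym_strongly_shifted n I \<and> xpow ` B \<subseteq> I}"


section \<open>Powers, symbolic powers and primary decompositions\<close>

text \<open>An empty intersection of ideals of a ring R is R, hence the factors \<open>carrier R\<close> below.\<close>

definition ideal_Inter :: "'a ring \<Rightarrow> 'a set set \<Rightarrow> 'a set" where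
  "ideal_Inter R A = carrier R \<inter> \<Inter>A"

definition ideal_pow :: "'a ring \<Rightarrow> 'a set \<Rightarrow> nat \<Rightarrow> 'a set" where
  "ideal_pow R J m = J [^]\<^bsub>ideals_set R\<^esub> m"

definition sym_power :: "nat \<Rightarrow> nat \<Rightarrow> nat \<Rightarrow> ('k::field) mpoly set" where
  "sym_power n j m = ideal_Inter (poly_ring n)
     {ideal_pow (poly_ring n) (Idl\<^bsub>poly_ring n\<^esub> (var ` F)) m | F. F \<subseteq> {1..n} \<and> card F = j}"

definition redundant :: "'a ring \<Rightarrow> 'i set \<Rightarrow> ('i \<Rightarrow> 'a set) \<Rightarrow> 'i \<Rightarrow> bool" where
  "redundant R A c j \<longleftrightarrow> ideal_Inter R (c ` (A - {j})) \<subseteq> c j"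

definition minimal_primes :: "'a ring \<Rightarrow> 'a set \<Rightarrow> 'a set set" where
  "minimal_primes R I =
     {P. primeideal P R \<and> I \<subseteq> P \<and> (\<forall>Q. primeideal Q R \<and> I \<subseteq> Q \<and> Q \<subseteq> P \<longrightarrow> Q = P)}"

text \<open>The localization at P is realised inside the fraction field of the ambient domain of
  polynomials, and \<open>loc_contraction n P J\<close> is the preimage in \<open>poly_ring n\<close> of the ideal
  generated by J in this localization.\<close>

definition localization :: "nat \<Rightarrow> ('k::field) mpoly set \<Rightarrow> 'k mpoly fract ring" where
  "localization n P = subring_on
     {Fraction_Field.Fract a s | a s. a \<in> carrier (poly_ring n) \<and> s \<in> carrier (poly_ring n) - P}"

definition loc_contraction ::
    "nat \<Rightarrow> ('k::field) mpoly set \<Rightarrow> 'k mpoly set \<Rightarrow> 'k mpoly set" where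
  "loc_contraction n P J =
     {f \<in> carrier (poly_ring n). Fraction_Field.Fract f 1 \<in> Idl\<^bsub>localization n P\<^esub> ((\<lambda>g. Fraction_Field.Fract g 1) ` J)}"

definition sym_power_Min :: "nat \<Rightarrow> ('k::field) mpoly set \<Rightarrow> nat \<Rightarrow> 'k mpoly set" where
  "sym_power_Min n I k = ideal_Inter (poly_ring n)
     ((\<lambda>P. loc_contraction n P (ideal_pow (poly_ring n) I k)) ` minimal_primes (poly_ring n) I)"

definition primary_ideal :: "'a ring \<Rightarrow> 'a set \<Rightarrow> bool" where
  "primary_ideal R Q \<longleftrightarrow> ideal Q R \<and> Q \<noteq> carrier R \<and>
     (\<forall>a \<in> carrier R. \<forall>b \<in> carrier R.
        a \<otimes>\<^bsub>R\<^esub> b \<in> Q \<longrightarrow> a \<in> Q \<or> (\<exists>m::nat. b [^]\<^bsub>R\<^esub> m \<in> Q))"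

definition ideal_radical :: "'a ring \<Rightarrow> 'a set \<Rightarrow> 'a set" where
  "ideal_radical R Q = {f \<in> carrier R. \<exists>m::nat. f [^]\<^bsub>R\<^esub> m \<in> Q}"

definition minimal_primary_decomposition :: "'a ring \<Rightarrow> 'a set \<Rightarrow> 'a set set \<Rightarrow> bool" where
  "minimal_primary_decomposition R J A \<longleftrightarrow>
     finite A \<and> (\<forall>Q \<in> A. primary_ideal R Q) \<and> J = ideal_Inter R A \<and>
     inj_on (ideal_radical R) A \<and> (\<forall>Q \<in> A. \<not> redundant R A id Q)"

end

theory Submission
  imports Defs
begin

text \<open>All ideals involved are monomial, so everything is a statement about exponent vectors. Write
  \<open>u(F)\<close> for the sum of the entries of \<open>u\<close> with index in \<open>F\<close>. A sorted integer vector \<open>u\<close> whose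
  prefix sums dominate those of \<open>\<lambda>\<close> is reached from \<open>\<lambda>\<close> by raising entries and by moving units from
  larger to smaller entries; hence \<open>x\<^sup>u\<close> lies in \<open>Sss({\<lambda>})\<close> iff \<open>u(F) \<ge> a\<^bsub>|F|\<^esub>\<close> for all \<open>F\<close>. Applied to
  \<open>k\<lambda>\<close>, the same reachability shows that \<open>u(F) \<ge> k a\<^bsub>|F|\<^esub>\<close> for all \<open>F\<close> characterises the \<open>k\<close>-th
  power, which is the decomposition. The component of \<open>F\<close> with \<open>|F| = j\<close> is irredundant as soon as some
  vector violates the inequality of \<open>F\<close> alone; taking it huge outside \<open>F\<close> reduces this to sorted
  vectors with \<open>j\<close> entries and total \<open>< k a\<^sub>j\<close> whose proper prefix sums are at least \<open>k a\<^sub>t\<close>.\<close>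

text \<open>The shifting condition of \<open>sym_strongly_shifted\<close> speaks of sorted vectors
  only, so the path from \<lambda> to \<open>u\<close> has to stay sorted at every step. For sums
  this is too rigid, since a summand of a sorted vector need not be sorted; therefore the sets
  \<open>card_bounded\<close> are shown to be closed under shifts at arbitrary pairs of entries. No
  splitting of \<open>u\<close> into \<open>k\<close> vectors is ever constructed.

  Primary ideals, radicals and localizations involve polynomials with several terms. There the
  grading by the degree in the variables of \<open>F\<close> takes over, through lowest homogeneous
  parts.

  The constants of (4) come from a single vector. Dividing k a_{j-1} evenly over the first j - 1
  entries gives the entries q and q + 1, and a last entry k \<lambda>_j - 1 misses the total k a_j
  by one. Sortedness asks for q + 1 \<le> k \<lambda>_j - 1. If \<lambda>_1 < \<lambda>_j, then
  a_{j-1} \<le> (j-1) \<lambda>_j - 1 by integrality, so k \<lambda>_j - q is at least k / (j-1);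
  this is the source of k > j(j-1).\<close>

definition mono_span :: "(nat \<Rightarrow>\<^sub>0 nat) set \<Rightarrow> ('k::field) mpoly set" where
  "mono_span U = {p. Poly_Mapping.keys p \<subseteq> U}"

text \<open>These are exactly the sets of exponents of monomials lying in a monomial ideal;
  \<open>mono_span\<close> of such a set is the ideal itself.\<close>

definition upset :: "nat \<Rightarrow> (nat \<Rightarrow>\<^sub>0 nat) set \<Rightarrow> bool" where
  "upset n U \<longleftrightarrow> U \<subseteq> expvecs n \<and> (\<forall>u \<in> U. \<forall>v \<in> expvecs n. u + v \<in> U)"

definition deg_on :: "nat set \<Rightarrow> (nat \<Rightarrow>\<^sub>0 nat) \<Rightarrow> nat" where
  "deg_on F u = (\<Sum>i\<in>F. Poly_Mapping.lookup u i)"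

definition deg_ge :: "nat \<Rightarrow> nat set \<Rightarrow> nat \<Rightarrow> (nat \<Rightarrow>\<^sub>0 nat) set" where
  "deg_ge n F m = {u \<in> expvecs n. m \<le> deg_on F u}"

text \<open>The value at 0 is all of \<open>expvecs n\<close>, because the zeroth power of an ideal
  is the whole ring.\<close>

fun nfold_sums :: "nat \<Rightarrow> (nat \<Rightarrow>\<^sub>0 nat) set \<Rightarrow> nat \<Rightarrow> (nat \<Rightarrow>\<^sub>0 nat) set" where
  "nfold_sums n U 0 = expvecs n"
| "nfold_sums n U (Suc k) = {u + v | u v. u \<in> nfold_sums n U k \<and> v \<in> U}"

lemma expvecs_iff: "u \<in> expvecs n \<longleftrightarrow> (\<forall>i. i \<notin> {1..n} \<longrightarrow> Poly_Mapping.lookup u i = 0)"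
  unfolding expvecs_def by (auto simp: in_keys_iff subset_iff)

lemma zero_in_expvecs [simp]: "0 \<in> expvecs n"
  by (simp add: expvecs_iff)

lemma add_in_expvecs: "u \<in> expvecs n \<Longrightarrow> v \<in> expvecs n \<Longrightarrow> u + v \<in> expvecs n"
  by (simp add: expvecs_iff lookup_add)

lemma deg_on_add: "deg_on F (u + v) = deg_on F u + deg_on F v"
  by (simp add: deg_on_def lookup_add sum.distrib)

lemma upset_expvecs: "upset n (expvecs n)"
  by (simp add: upset_def add_in_expvecs)

lemma upset_deg_ge: "upset n (deg_ge n F m)"
  by (auto simp: upset_def deg_ge_def add_in_expvecs deg_on_add)

lemma upsetD: "upset n U \<Longrightarrow> u \<in> U \<Longrightarrow> v \<in> expvecs n \<Longrightarrow> u + v \<in> U"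
  by (simp add: upset_def)

lemma upset_subset: "upset n U \<Longrightarrow> U \<subseteq> expvecs n"
  by (simp add: upset_def)

lemma upset_nfold_sums:
  assumes "upset n U"
  shows "upset n (nfold_sums n U k)"
proof (induction k)
  case 0
  show ?case by (simp add: upset_expvecs)
next
  case (Suc k)
  have "u + v + w \<in> nfold_sums n U (Suc k)"
    if "u \<in> nfold_sums n U k" "v \<in> U" "w \<in> expvecs n" for u v w
    using that upsetD[OF assms] by (auto simp: add.assoc)
  moreover have "nfold_sums n U (Suc k) \<subseteq> expvecs n"
    using upset_subset[OF Suc] upset_subset[OF assms] by (auto intro: add_in_expvecs)
  ultimately show ?case
    unfolding upset_def by force
qed


section \<open>Rings and ideals carried by subsets of a commutative ring\<close>

lemma subring_on_simps [simp]:
  "carrier (subring_on C) = C" "x \<otimes>\<^bsub>subring_on C\<^esub> y = x * y" "x \<oplus>\<^bsub>subring_on C\<^esub> y = x + y"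
  "\<one>\<^bsub>subring_on C\<^esub> = 1" "\<zero>\<^bsub>subring_on C\<^esub> = 0"
  by (simp_all add: subring_on_def)

lemma cring_subring_on:
  fixes C :: "'a::comm_ring_1 set"
  assumes "0 \<in> C" "1 \<in> C"
    and "\<And>x y. x \<in> C \<Longrightarrow> y \<in> C \<Longrightarrow> x + y \<in> C"
    and "\<And>x y. x \<in> C \<Longrightarrow> y \<in> C \<Longrightarrow> x * y \<in> C"
    and "\<And>x. x \<in> C \<Longrightarrow> - x \<in> C"
  shows "cring (subring_on C)"
proof (rule cringI)
  show "abelian_group (subring_on C)"
  proof (rule abelian_groupI)
    fix x assume "x \<in> carrier (subring_on C)"
    then show "\<exists>y\<in>carrier (subring_on C). y \<oplus>\<^bsub>subring_on C\<^esub> x = \<zero>\<^bsub>subring_on C\<^esub>"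
      using assms(5) by (intro bexI[of _ "- x"]) auto
  qed (use assms in \<open>auto simp: algebra_simps\<close>)
  show "Group.comm_monoid (subring_on C)"
    by (rule comm_monoidI) (use assms in \<open>auto simp: algebra_simps\<close>)
qed (simp add: algebra_simps)

text \<open>Closure of \<open>J\<close> under negation is obtained by multiplying with
  \<open>- 1\<close>, which lies in \<open>C\<close>.\<close>

lemma idealI_subring_on:
  fixes C :: "'a::comm_ring_1 set"
  assumes "cring (subring_on C)" "J \<subseteq> C" "0 \<in> J"
    and "\<And>x y. x \<in> J \<Longrightarrow> y \<in> J \<Longrightarrow> x + y \<in> J"
    and "\<And>x y. x \<in> J \<Longrightarrow> y \<in> C \<Longrightarrow> x * y \<in> J"
  shows "ideal J (subring_on C)"
proof -
  interpret cring "subring_on C" by fact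
  have minus: "\<ominus>\<^bsub>subring_on C\<^esub> x = - x" if "x \<in> C" for x
    using l_neg[of x] that by (simp add: eq_neg_iff_add_eq_0)
  have minus_one: "- 1 \<in> C"
    using a_inv_closed[of "\<one>\<^bsub>subring_on C\<^esub>"] one_closed minus[of 1] by simp
  have minusJ: "- x \<in> J" if "x \<in> J" for x
    using assms(5)[OF that minus_one] by simp
  show ?thesis
  proof (rule idealI)
    show "ring (subring_on C)" by (rule ring_axioms)
    show "subgroup J (add_monoid (subring_on C))"
    proof (rule subgroup.intro)
      fix x assume x: "x \<in> J"
      then have "inv\<^bsub>add_monoid (subring_on C)\<^esub> x = - x"
        using minus[of x] assms(2) unfolding a_inv_def by blast
      then show "inv\<^bsub>add_monoid (subring_on C)\<^esub> x \<in> J"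
        using minusJ[OF x] by simp
    qed (use assms(2-4) in auto)
  qed (use assms(5) in \<open>auto simp: mult.commute\<close>)
qed

lemma ideal_subring_onD:
  fixes C :: "'a::comm_ring_1 set"
  assumes "ideal J (subring_on C)"
  shows "J \<subseteq> C" "0 \<in> J"
    and "x \<in> J \<Longrightarrow> y \<in> J \<Longrightarrow> x + y \<in> J"
    and "x \<in> J \<Longrightarrow> y \<in> C \<Longrightarrow> x * y \<in> J"
proof -
  interpret ideal J "subring_on C" by fact
  show "J \<subseteq> C" using Icarr by auto
  show "0 \<in> J" using additive_subgroup.zero_closed[OF is_additive_subgroup] by simp
  show "x \<in> J \<Longrightarrow> y \<in> J \<Longrightarrow> x + y \<in> J" using additive_subgroup.a_closed[OF is_additive_subgroup, of x y] by simp
  show "x \<in> J \<Longrightarrow> y \<in> C \<Longrightarrow> x * y \<in> J" using I_r_closed[of x y] by simp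
qed

lemma nat_pow_subring_on [simp]: "x [^]\<^bsub>subring_on C\<^esub> (m::nat) = x ^ m"
  by (induction m) (simp_all add: nat_pow_def subring_on_def mult.commute)


section \<open>Monomial ideals\<close>

lemma poly_ring_eq: "poly_ring n = subring_on (mono_span (expvecs n))"
  by (simp add: poly_ring_def mono_span_def)

lemma carrier_poly_ring: "carrier (poly_ring n) = mono_span (expvecs n)"
  by (simp add: poly_ring_eq)

lemma mono_spanD: "p \<in> mono_span U \<Longrightarrow> u \<in> Poly_Mapping.keys p \<Longrightarrow> u \<in> U"
  by (auto simp: mono_span_def)

lemma single_in_mono_span [simp]: "Poly_Mapping.single u c \<in> mono_span U \<longleftrightarrow> c = 0 \<or> u \<in> U"
  by (simp add: mono_span_def)

lemma xpow_in_mono_span [simp]: "xpow u \<in> mono_span U \<longleftrightarrow> u \<in> U"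
  by (simp add: xpow_def)

lemma mono_span_subset_iff [simp]:
  "(mono_span U :: 'k::field mpoly set) \<subseteq> mono_span V \<longleftrightarrow> U \<subseteq> V"
proof
  assume "(mono_span U :: 'k mpoly set) \<subseteq> mono_span V"
  then show "U \<subseteq> V"
    by (metis subset_iff xpow_in_mono_span)
qed (auto simp: mono_span_def)

lemma mono_span_inject [simp]:
  "(mono_span U :: 'k::field mpoly set) = mono_span V \<longleftrightarrow> U = V"
  by (metis mono_span_subset_iff order_antisym order_refl)

lemma zero_in_mono_span [simp]: "0 \<in> mono_span U"
  by (simp add: mono_span_def)

lemma add_in_mono_span: "p \<in> mono_span U \<Longrightarrow> q \<in> mono_span U \<Longrightarrow> p + q \<in> mono_span U"
  using keys_add[of p q] unfolding mono_span_def by blast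

lemma mult_in_mono_span:
  assumes "p \<in> mono_span U" "q \<in> mono_span V" "\<And>u v. u \<in> U \<Longrightarrow> v \<in> V \<Longrightarrow> u + v \<in> W"
  shows "p * q \<in> mono_span W"
  using keys_mult[of p q] assms unfolding mono_span_def by blast

lemma poly_eq_sum_single:
  "(p :: 'a \<Rightarrow>\<^sub>0 'b::comm_monoid_add)
     = (\<Sum>u\<in>Poly_Mapping.keys p. Poly_Mapping.single u (Poly_Mapping.lookup p u))"
  by (rule poly_mapping_eqI)
    (auto simp: lookup_sum lookup_single when_def sum.delta' in_keys_iff cong: if_cong)

text \<open>A polynomial is the finite sum of its terms. Only additive closure of \<open>J\<close>
  enters, so the criterion also serves for ideal products and for preimages from a
  localization.\<close>

lemma mono_span_subsetI:
  fixes J :: "'k::field mpoly set"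
  assumes "0 \<in> J" "\<And>x y. x \<in> J \<Longrightarrow> y \<in> J \<Longrightarrow> x + y \<in> J"
    and "\<And>u c. u \<in> U \<Longrightarrow> Poly_Mapping.single u c \<in> J"
  shows "mono_span U \<subseteq> J"
proof
  fix p :: "'k mpoly" assume p: "p \<in> mono_span U"
  have "(\<Sum>u\<in>A. Poly_Mapping.single u (Poly_Mapping.lookup p u)) \<in> J"
    if "finite A" "A \<subseteq> U" for A
    using that by (induction A) (use assms in auto)
  from this[of "Poly_Mapping.keys p"] p show "p \<in> J"
    unfolding poly_eq_sum_single[of p, symmetric] by (simp add: mono_span_def)
qed

lemma cring_poly_ring: "cring (poly_ring n :: 'k::field mpoly ring)"
  unfolding poly_ring_eq
proof (rule cring_subring_on)
  show "(1::'k mpoly) \<in> mono_span (expvecs n)"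
    by (simp add: mono_span_def)
  show "p * q \<in> mono_span (expvecs n)"
    if "p \<in> mono_span (expvecs n)" "q \<in> mono_span (expvecs n)" for p q :: "'k mpoly"
    using that by (rule mult_in_mono_span) (rule add_in_expvecs)
  show "- p \<in> mono_span (expvecs n)" if "p \<in> mono_span (expvecs n)" for p :: "'k mpoly"
    using that by (simp add: mono_span_def keys_def)
qed (simp_all add: add_in_mono_span)

lemma ideal_mono_span:
  assumes "upset n U"
  shows "ideal (mono_span U) (poly_ring n)"
  unfolding poly_ring_eq
proof (rule idealI_subring_on)
  show "p * q \<in> mono_span U" if "p \<in> mono_span U" "q \<in> mono_span (expvecs n)"
    for p q :: "'a mpoly"
    using that by (rule mult_in_mono_span) (rule upsetD[OF assms])
qed (use cring_poly_ring[of n] upset_subset[OF assms] in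
      \<open>simp_all add: poly_ring_eq add_in_mono_span\<close>)

lemma ideal_poly_ringD:
  fixes J :: "'k::field mpoly set"
  assumes "ideal J (poly_ring n)"
  shows "J \<subseteq> mono_span (expvecs n)" "0 \<in> J"
    and "x \<in> J \<Longrightarrow> y \<in> J \<Longrightarrow> x + y \<in> J"
    and "x \<in> J \<Longrightarrow> y \<in> mono_span (expvecs n) \<Longrightarrow> x * y \<in> J"
  using ideal_subring_onD[OF assms[unfolded poly_ring_eq]] by blast+

lemma xpow_add: "xpow (u + v) = xpow u * xpow v"
  by (simp add: xpow_def mult_single)

lemma single_eq_xpow_mult: "Poly_Mapping.single u c = xpow u * Poly_Mapping.single 0 c"
  by (simp add: xpow_def mult_single)

lemma mono_span_subset_ideal:
  assumes "ideal J (poly_ring n)" "\<And>u. u \<in> U \<Longrightarrow> xpow u \<in> J"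
  shows "mono_span U \<subseteq> J"
proof (rule mono_span_subsetI)
  show "Poly_Mapping.single u c \<in> J" if "u \<in> U" for u c
    unfolding single_eq_xpow_mult[of u c]
    using assms that by (auto intro: ideal_poly_ringD(4))
qed (use ideal_poly_ringD[OF assms(1)] in auto)

lemma genideal_xpow:
  assumes "S \<subseteq> expvecs n"
  shows "Idl\<^bsub>poly_ring n\<^esub> (xpow ` S) = mono_span {u + v | u v. u \<in> S \<and> v \<in> expvecs n}"
    (is "?L = mono_span ?U")
proof
  interpret cring "poly_ring n" by (rule cring_poly_ring)
  have S: "xpow ` S \<subseteq> carrier (poly_ring n)"
    using assms by (auto simp: carrier_poly_ring)
  have "upset n ?U"
    unfolding upset_def
    using assms by (auto simp: add.assoc intro!: add_in_expvecs) (use add_in_expvecs in blast)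
  moreover have "u \<in> ?U" if "u \<in> S" for u
    using that by force
  ultimately show "?L \<subseteq> mono_span ?U"
    by (intro genideal_minimal ideal_mono_span) auto
  show "mono_span ?U \<subseteq> ?L"
  proof (rule mono_span_subset_ideal)
    show id: "ideal ?L (poly_ring n)"
      using S by (rule genideal_ideal)
    have "xpow u * xpow v \<in> ?L" if "u \<in> S" "v \<in> expvecs n" for u v
      by (rule ideal_poly_ringD(4)[OF id]) (use genideal_self[OF S] that in auto)
    then show "xpow w \<in> ?L" if "w \<in> ?U" for w
      using that by (auto simp: xpow_add)
  qed
qed

lemma genideal_xpow_upset:
  assumes "upset n U"
  shows "Idl\<^bsub>poly_ring n\<^esub> (xpow ` U) = mono_span U"
proof -
  have "{u + v | u v. u \<in> U \<and> v \<in> expvecs n} = U"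
    using upsetD[OF assms] by (auto, metis add_0_right zero_in_expvecs)
  then show ?thesis
    by (simp add: genideal_xpow[OF upset_subset[OF assms]])
qed

text \<open>\<open>ideal_prod\<close> is the additive closure of the products of elements, so
  arbitrary exponent sets are allowed, and powers of monomial ideals turn into sumsets.\<close>

lemma ideal_prod_mono_span:
  "ideal_prod (poly_ring n) (mono_span U) (mono_span V)
     = (mono_span {u + v | u v. u \<in> U \<and> v \<in> V} :: 'k::field mpoly set)" (is "?L = mono_span ?W")
proof
  show "?L \<subseteq> mono_span ?W"
  proof
    fix p :: "'k mpoly" assume "p \<in> ?L"
    then show "p \<in> mono_span ?W"
    proof induction
      case (prod i j)
      then show ?case
        by (auto simp: poly_ring_eq intro!: mult_in_mono_span[of i U j V])
    next
      case (sum s1 s2)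
      then show ?case
        by (auto simp: poly_ring_eq intro: add_in_mono_span)
    qed
  qed
  show "mono_span ?W \<subseteq> ?L"
  proof (rule mono_span_subsetI)
    \<comment> \<open>\<open>ideal_prod\<close> is generated by products and sums alone, so 0 enters
      as the product of 0 and 0.\<close>
    show "(0 :: 'k mpoly) \<in> ?L"
      using ideal_prod.prod[of "0::'k mpoly" "mono_span U" "0" "mono_span V" "poly_ring n"]
      by (simp add: poly_ring_eq)
    show "x + y \<in> ?L" if "x \<in> ?L" "y \<in> ?L" for x y :: "'k mpoly"
      using ideal_prod.sum[OF that] by (simp add: poly_ring_eq)
    fix w and c :: 'k assume "w \<in> ?W"
    then obtain u v where w: "w = u + v" "u \<in> U" "v \<in> V" by blast
    have "xpow u * Poly_Mapping.single v c \<in> ?L"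
      using ideal_prod.prod[of "xpow u" "mono_span U" "Poly_Mapping.single v c" "mono_span V" "poly_ring n"]
        w by (simp add: poly_ring_eq)
    then show "Poly_Mapping.single w c \<in> ?L"
      by (simp add: w xpow_def mult_single)
  qed
qed

lemma ideal_pow_0 [simp]: "ideal_pow R J 0 = carrier R"
  and ideal_pow_Suc [simp]: "ideal_pow R J (Suc m) = ideal_prod R (ideal_pow R J m) J"
  by (simp_all add: ideal_pow_def ideals_set_def nat_pow_def)

lemma ideal_pow_mono_span:
  "ideal_pow (poly_ring n) (mono_span U) k = mono_span (nfold_sums n U k)"
  by (induction k) (simp_all add: carrier_poly_ring ideal_prod_mono_span)

section \<open>Powers of ideals generated by variables\<close>

lemma deg_on_single [simp]:
  "finite F \<Longrightarrow> deg_on F (Poly_Mapping.single i c) = (if i \<in> F then c else 0)"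
  by (simp add: deg_on_def lookup_single when_def sum.delta' cong: if_cong)

lemma deg_on_zero [simp]: "deg_on F 0 = 0"
  by (simp add: deg_on_def)

lemma single_in_expvecs: "i \<in> {1..n} \<Longrightarrow> Poly_Mapping.single i c \<in> expvecs n"
  by (auto simp: expvecs_iff lookup_single when_def)

lemma deg_ge_subset: "deg_ge n F m \<subseteq> expvecs n"
  by (auto simp: deg_ge_def)

lemma deg_ge_antimono: "m \<le> m' \<Longrightarrow> deg_ge n F m' \<subseteq> deg_ge n F m"
  by (auto simp: deg_ge_def)

text \<open>Subtraction of exponent vectors is truncated; the bound on the entry makes it
  cancel.\<close>

lemma diff_single_add:
  assumes "c \<le> Poly_Mapping.lookup u i"
  shows "(u - Poly_Mapping.single i c) + Poly_Mapping.single i c = (u :: nat \<Rightarrow>\<^sub>0 nat)"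
  using assms by (intro poly_mapping_eqI) (auto simp: lookup_add lookup_minus lookup_single when_def)

lemma diff_in_expvecs: "u \<in> expvecs n \<Longrightarrow> u - v \<in> expvecs n"
  by (simp add: expvecs_iff lookup_minus)

lemma deg_on_posE:
  assumes "1 \<le> deg_on F u"
  obtains i where "i \<in> F" "1 \<le> Poly_Mapping.lookup u i"
  using assms unfolding deg_on_def
  by (metis Suc_le_eq One_nat_def neq0_conv not_one_le_zero sum.neutral)

lemma genideal_var:
  assumes "F \<subseteq> {1..n}"
  shows "Idl\<^bsub>poly_ring n\<^esub> (var ` F) = (mono_span (deg_ge n F 1) :: 'k::field mpoly set)"
proof -
  define S where "S = (\<lambda>i. Poly_Mapping.single i (1::nat)) ` F"
  have fin: "finite F" using assms finite_subset by blast
  have S: "S \<subseteq> expvecs n"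
    using assms single_in_expvecs unfolding S_def by blast
  have "{u + v | u v. u \<in> S \<and> v \<in> expvecs n} = deg_ge n F 1"
  proof (intro equalityI subsetI)
    fix w assume "w \<in> {u + v | u v. u \<in> S \<and> v \<in> expvecs n}"
    then show "w \<in> deg_ge n F 1"
      using S fin by (auto simp: deg_ge_def deg_on_add S_def intro!: add_in_expvecs)
  next
    fix w assume w: "w \<in> deg_ge n F 1"
    then obtain i where i: "i \<in> F" "1 \<le> Poly_Mapping.lookup w i"
      using deg_on_posE[of F w] by (auto simp: deg_ge_def)
    have "w = Poly_Mapping.single i 1 + (w - Poly_Mapping.single i 1)"
      using diff_single_add[OF i(2)] by (simp add: add.commute)
    moreover have "w - Poly_Mapping.single i 1 \<in> expvecs n"
      using w by (simp add: deg_ge_def diff_in_expvecs)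
    ultimately show "w \<in> {u + v | u v. u \<in> S \<and> v \<in> expvecs n}"
      using i(1) unfolding S_def by blast
  qed
  moreover have "var ` F = (xpow ` S :: 'k mpoly set)"
    by (simp add: S_def var_def image_image)
  ultimately show ?thesis
    by (simp only: genideal_xpow[OF S])
qed

text \<open>A monomial of positive degree in the variables of \<open>F\<close> is divisible by one
  of them; splitting off such a variable lowers this degree by exactly one.\<close>

lemma nfold_sums_deg_ge:
  assumes "F \<subseteq> {1..n}"
  shows "nfold_sums n (deg_ge n F 1) m = deg_ge n F m"
proof (induction m)
  case 0
  show ?case by (auto simp: deg_ge_def)
next
  case (Suc m)
  have fin: "finite F" using assms finite_subset by blast
  have "w \<in> {u + v | u v. u \<in> deg_ge n F m \<and> v \<in> deg_ge n F 1}" if w: "w \<in> deg_ge n F (Suc m)" for w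
  proof -
    obtain i where i: "i \<in> F" "1 \<le> Poly_Mapping.lookup w i"
      using w deg_on_posE[of F w] by (auto simp: deg_ge_def)
    note eq = diff_single_add[OF i(2)]
    have "deg_on F (w - Poly_Mapping.single i 1) + 1 = deg_on F w"
      using i(1) fin by (subst (2) eq[symmetric]) (simp add: deg_on_add)
    then have "w - Poly_Mapping.single i 1 \<in> deg_ge n F m" "Poly_Mapping.single i 1 \<in> deg_ge n F 1"
      using w i(1) assms fin by (auto simp: deg_ge_def diff_in_expvecs intro!: single_in_expvecs)
    then show ?thesis
      using eq by (metis (mono_tags, lifting) mem_Collect_eq)
  qed
  moreover have "u + v \<in> deg_ge n F (Suc m)" if "u \<in> deg_ge n F m" "v \<in> deg_ge n F 1" for u v
    using that by (auto simp: deg_ge_def deg_on_add add_in_expvecs)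
  ultimately show ?case
    unfolding nfold_sums.simps Suc by blast
qed

lemma ideal_pow_genideal_var:
  assumes "F \<subseteq> {1..n}"
  shows "ideal_pow (poly_ring n) (Idl\<^bsub>poly_ring n\<^esub> (var ` F)) m = mono_span (deg_ge n F m)"
  by (simp only: genideal_var[OF assms] ideal_pow_mono_span nfold_sums_deg_ge[OF assms])

lemma mono_span_Int_Inter:
  "mono_span V \<inter> \<Inter> (mono_span ` A) = mono_span (V \<inter> \<Inter> A)"
  by (auto simp: mono_span_def)

lemma ideal_Inter_mono_span:
  "ideal_Inter (poly_ring n) (mono_span ` A) = mono_span (expvecs n \<inter> \<Inter> A)"
  by (simp add: ideal_Inter_def carrier_poly_ring mono_span_Int_Inter)

lemma sym_power_eq:
  "(sym_power n j m :: 'k::field mpoly set) = mono_span {u \<in> expvecs n. \<forall>F \<subseteq> {1..n}. card F = j \<longrightarrow> m \<le> deg_on F u}"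
proof -
  have "{ideal_pow (poly_ring n) (Idl\<^bsub>poly_ring n\<^esub> (var ` F)) m | F. F \<subseteq> {1..n} \<and> card F = j}
      = (mono_span ` {deg_ge n F m | F. F \<subseteq> {1..n} \<and> card F = j} :: 'k mpoly set set)"
    unfolding setcompr_eq_image image_image
    by (intro image_cong refl ideal_pow_genideal_var) blast
  then have "sym_power n j m
      = (mono_span (expvecs n \<inter> \<Inter> {deg_ge n F m | F. F \<subseteq> {1..n} \<and> card F = j}) :: 'k mpoly set)"
    unfolding sym_power_def by (simp only: ideal_Inter_mono_span)
  also have "expvecs n \<inter> \<Inter> {deg_ge n F m | F. F \<subseteq> {1..n} \<and> card F = j}
      = {u \<in> expvecs n. \<forall>F \<subseteq> {1..n}. card F = j \<longrightarrow> m \<le> deg_on F u}"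
    by (auto simp: deg_ge_def)
  finally show ?thesis .
qed


section \<open>The action of permutations on polynomials and exponents\<close>

lemma lookup_map_key: "inj f \<Longrightarrow> Poly_Mapping.lookup (Poly_Mapping.map_key f p) k = Poly_Mapping.lookup p (f k)"
  by (simp add: map_key.rep_eq)

lemma map_key_inverse:
  fixes f :: "'a \<Rightarrow> 'a"
  assumes "bij f"
  shows "Poly_Mapping.map_key (inv_into UNIV f) (Poly_Mapping.map_key f p) = p"
    and "Poly_Mapping.map_key f (Poly_Mapping.map_key (inv_into UNIV f) p) = p"
  using assms bij_imp_bij_inv[OF assms]
  by (auto intro!: poly_mapping_eqI simp: lookup_map_key bij_is_inj bij_is_surj surj_f_inv_f inv_f_f)

lemma bij_map_key:
  fixes f :: "'a \<Rightarrow> 'a"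
  assumes "bij f"
  shows "bij (Poly_Mapping.map_key f)"
  using map_key_inverse[OF assms] by (intro o_bij[of "Poly_Mapping.map_key (inv_into UNIV f)"]) (auto simp: fun_eq_iff)

lemma inv_map_key:
  fixes f :: "'a \<Rightarrow> 'a"
  assumes "bij f"
  shows "inv_into UNIV (Poly_Mapping.map_key f) = Poly_Mapping.map_key (inv_into UNIV f)"
  using map_key_inverse[OF assms] by (intro inv_unique_comp) (auto simp: fun_eq_iff)

text \<open>\<open>perm_poly\<close> precomposes coefficients with \<open>map_key \<sigma>\<close>,
  so supports are pulled back: the image of a span belongs to a preimage of exponents.\<close>

lemma perm_poly_mono_span:
  assumes "bij \<sigma>"
  shows "perm_poly \<sigma> ` mono_span U = (mono_span (Poly_Mapping.map_key \<sigma> -` U) :: 'k::field mpoly set)"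
proof (intro equalityI subsetI)
  note inj = bij_is_inj[OF bij_map_key[OF assms]]
  fix p :: "'k mpoly"
  { assume "p \<in> perm_poly \<sigma> ` mono_span U"
    then show "p \<in> mono_span (Poly_Mapping.map_key \<sigma> -` U)"
      by (auto simp: perm_poly_def mono_span_def keys_map_key[OF inj]) }
  assume p: "p \<in> mono_span (Poly_Mapping.map_key \<sigma> -` U)"
  have "p = perm_poly \<sigma> (Poly_Mapping.map_key (Poly_Mapping.map_key (inv_into UNIV \<sigma>)) p)"
    using map_key_inverse(2)[OF bij_map_key[OF assms], of p]
    by (simp add: perm_poly_def inv_map_key[OF assms])
  moreover have "Poly_Mapping.map_key (Poly_Mapping.map_key (inv_into UNIV \<sigma>)) p \<in> mono_span U"
    unfolding mono_span_def
  proof (intro CollectI subsetI)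
    fix u assume "u \<in> Poly_Mapping.keys (Poly_Mapping.map_key (Poly_Mapping.map_key (inv_into UNIV \<sigma>)) p)"
    then have "Poly_Mapping.map_key (inv_into UNIV \<sigma>) u \<in> Poly_Mapping.keys p"
      by (simp add: keys_map_key[OF bij_is_inj[OF bij_map_key[OF bij_imp_bij_inv[OF assms]]]])
    then show "u \<in> U"
      using mono_spanD[OF p] map_key_inverse(2)[OF assms, of u] by force
  qed
  ultimately show "p \<in> perm_poly \<sigma> ` mono_span U"
    by blast
qed

lemma map_key_in_expvecs_iff:
  assumes "\<sigma> permutes {1..n}"
  shows "Poly_Mapping.map_key \<sigma> u \<in> expvecs n \<longleftrightarrow> u \<in> expvecs n"
  using permutes_in_image[OF assms] permutes_not_in[OF assms]
  by (simp add: expvecs_iff lookup_map_key permutes_inj[OF assms])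

lemma deg_on_map_key:
  assumes "inj \<sigma>"
  shows "deg_on F (Poly_Mapping.map_key \<sigma> u) = deg_on (\<sigma> ` F) u"
  unfolding deg_on_def
  by (simp add: lookup_map_key[OF assms] sum.reindex[OF inj_on_subset[OF assms]])

lemma vimage_map_key_deg_ge:
  assumes "\<sigma> permutes {1..n}"
  shows "Poly_Mapping.map_key \<sigma> -` deg_ge n F m = deg_ge n (\<sigma> ` F) m"
  by (auto simp: deg_ge_def map_key_in_expvecs_iff[OF assms] deg_on_map_key[OF permutes_inj[OF assms]])


section \<open>Primary ideals generated by variables\<close>

text \<open>Grade by the degree on \<open>F\<close>. If the lowest degree \<open>d\<close> of
  \<open>p\<close> were below \<open>m\<close>, then the degree \<open>d\<close> part of
  \<open>p\<close> times the degree 0 part of \<open>q\<close> would be nonzero, polynomials being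
  an integral domain, and it would be the degree \<open>d\<close> part of
  \<open>p * q\<close>.\<close>

lemma mono_span_deg_ge_primary:
  fixes p q :: "'k::field mpoly"
  assumes p: "p \<in> mono_span (expvecs n)" and q: "q \<in> mono_span (expvecs n)"
    and pq: "p * q \<in> mono_span (deg_ge n F m)" and q1: "q \<notin> mono_span (deg_ge n F 1)"
  shows "p \<in> mono_span (deg_ge n F m)"
proof (rule ccontr)
  assume "p \<notin> mono_span (deg_ge n F m)"
  then obtain u0 where u0: "u0 \<in> Poly_Mapping.keys p" "deg_on F u0 < m"
    using p unfolding mono_span_def deg_ge_def by (auto simp: subset_iff not_le)
  obtain v0 where v0: "v0 \<in> Poly_Mapping.keys q" "deg_on F v0 = 0"
    using q q1 by (force simp: mono_span_def deg_ge_def)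
  define d where "d = Min (deg_on F ` Poly_Mapping.keys p)"
  have d_le: "d \<le> deg_on F u" if "u \<in> Poly_Mapping.keys p" for u
    using that by (simp add: d_def)
  have "d \<in> deg_on F ` Poly_Mapping.keys p"
    unfolding d_def using u0 by (intro Min_in) auto
  then obtain u1 where u1: "u1 \<in> Poly_Mapping.keys p" "deg_on F u1 = d" by auto
  \<comment> \<open>The homogeneous part of degree \<open>e\<close> for the grading by
    \<open>deg_on F\<close>.\<close>
  define hpart :: "nat \<Rightarrow> 'k mpoly \<Rightarrow> 'k mpoly" where
    "hpart e r = Poly_Mapping.mapp (\<lambda>u c. c when deg_on F u = e) r" for e r
  have lookup_hpart: "Poly_Mapping.lookup (hpart e r) u = (Poly_Mapping.lookup r u when deg_on F u = e)" for e r u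
    by (auto simp: hpart_def lookup_mapp when_def in_keys_iff)
  have "hpart d p \<noteq> 0" "hpart 0 q \<noteq> 0"
    using u1 v0 lookup_hpart[of d p u1] lookup_hpart[of 0 q v0] by (auto simp: in_keys_iff)
  then have "hpart d p * hpart 0 q \<noteq> 0" by simp
  then obtain w where w: "w \<in> Poly_Mapping.keys (hpart d p * hpart 0 q)"
    by (metis all_not_in_conv keys_eq_empty)
  then obtain x y where xy: "w = x + y" "x \<in> Poly_Mapping.keys (hpart d p)" "y \<in> Poly_Mapping.keys (hpart 0 q)"
    using keys_mult by blast
  have deg_w: "deg_on F w = d"
    using xy by (auto simp: deg_on_add lookup_hpart in_keys_iff)
  \<comment> \<open>The two remaining contributions to \<open>p * q\<close> have only terms of
    degree above \<open>d\<close>, so they cannot cancel the term at \<open>w\<close>.\<close>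
  have "w \<notin> Poly_Mapping.keys (hpart d p * (q - hpart 0 q))"
  proof
    assume "w \<in> Poly_Mapping.keys (hpart d p * (q - hpart 0 q))"
    then obtain x y where "w = x + y" "x \<in> Poly_Mapping.keys (hpart d p)" "y \<in> Poly_Mapping.keys (q - hpart 0 q)"
      using keys_mult by blast
    then show False
      using deg_w by (auto simp: deg_on_add lookup_hpart lookup_minus in_keys_iff when_def split: if_splits)
  qed
  moreover have "w \<notin> Poly_Mapping.keys ((p - hpart d p) * q)"
  proof
    assume "w \<in> Poly_Mapping.keys ((p - hpart d p) * q)"
    then obtain x y where xy: "w = x + y" "x \<in> Poly_Mapping.keys (p - hpart d p)"
      using keys_mult by blast
    then have "x \<in> Poly_Mapping.keys p" "deg_on F x \<noteq> d"
      by (auto simp: lookup_hpart lookup_minus in_keys_iff when_def split: if_splits)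
    then show False
      using xy d_le[of x] deg_w by (auto simp: deg_on_add)
  qed
  moreover have "p * q = hpart d p * hpart 0 q + (hpart d p * (q - hpart 0 q) + (p - hpart d p) * q)"
    by (simp add: algebra_simps)
  ultimately have "Poly_Mapping.lookup (p * q) w = Poly_Mapping.lookup (hpart d p * hpart 0 q) w"
    by (simp add: lookup_add in_keys_iff)
  then have "w \<in> Poly_Mapping.keys (p * q)"
    using w by (simp add: in_keys_iff)
  then have "m \<le> deg_on F w"
    using pq by (auto simp: mono_span_def deg_ge_def)
  then show False
    using deg_w d_le[OF u0(1)] u0(2) by simp
qed

lemma one_in_mono_span [simp]: "1 \<in> mono_span U \<longleftrightarrow> 0 \<in> U"
  by (simp add: mono_span_def)

lemma zero_in_deg_ge_iff [simp]: "0 \<in> deg_ge n F m \<longleftrightarrow> m = 0"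
  by (simp add: deg_ge_def)

lemma primeideal_deg_ge:
  "primeideal (mono_span (deg_ge n F 1) :: 'k::field mpoly set) (poly_ring n)"
proof (rule primeidealI)
  show "carrier (poly_ring n) \<noteq> (mono_span (deg_ge n F 1) :: 'k mpoly set)"
    using zero_in_deg_ge_iff[of n F 1] by (auto simp: carrier_poly_ring simp del: zero_in_deg_ge_iff)
  fix a b :: "'k mpoly"
  assume "a \<in> carrier (poly_ring n)" "b \<in> carrier (poly_ring n)"
    "a \<otimes>\<^bsub>poly_ring n\<^esub> b \<in> mono_span (deg_ge n F 1)"
  then show "a \<in> mono_span (deg_ge n F 1) \<or> b \<in> mono_span (deg_ge n F 1)"
    using mono_span_deg_ge_primary[of a n b F 1] by (auto simp: poly_ring_eq)
qed (rule ideal_mono_span upset_deg_ge cring_poly_ring)+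

lemma power_in_mono_span_deg_ge:
  assumes "p \<in> mono_span (deg_ge n F 1)"
  shows "p ^ m \<in> mono_span (deg_ge n F m)"
proof (induction m)
  case (Suc m)
  show ?case
    unfolding power_Suc
    by (rule mult_in_mono_span[OF assms Suc]) (auto simp: deg_ge_def deg_on_add add_in_expvecs)
qed simp

lemma primary_ideal_deg_ge:
  assumes "1 \<le> m"
  shows "primary_ideal (poly_ring n) (mono_span (deg_ge n F m) :: 'k::field mpoly set)"
  unfolding primary_ideal_def
proof (intro conjI ballI impI)
  show "(mono_span (deg_ge n F m) :: 'k mpoly set) \<noteq> carrier (poly_ring n)"
    using assms zero_in_deg_ge_iff[of n F m]
    by (auto simp: carrier_poly_ring simp del: zero_in_deg_ge_iff)
  fix a b :: "'k mpoly"
  assume "a \<in> carrier (poly_ring n)" "b \<in> carrier (poly_ring n)"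
    "a \<otimes>\<^bsub>poly_ring n\<^esub> b \<in> mono_span (deg_ge n F m)"
  then show "a \<in> mono_span (deg_ge n F m) \<or>
      (\<exists>k::nat. b [^]\<^bsub>poly_ring n\<^esub> k \<in> mono_span (deg_ge n F m))"
    using mono_span_deg_ge_primary[of a n b F m] power_in_mono_span_deg_ge[of b n F m]
    by (auto simp: poly_ring_eq)
qed (rule ideal_mono_span upset_deg_ge)+

text \<open>For \<open>1 \<le> m\<close> the ideal lies in the prime
  \<open>mono_span (deg_ge n F 1)\<close>, which contains \<open>p\<close> as soon as it contains a
  power of \<open>p\<close>; conversely \<open>p ^ m\<close> has degree at least \<open>m\<close> on
  \<open>F\<close>.\<close>

lemma ideal_radical_deg_ge:
  assumes "1 \<le> m"
  shows "ideal_radical (poly_ring n) (mono_span (deg_ge n F m)) = (mono_span (deg_ge n F 1) :: 'k::field mpoly set)"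
proof (intro equalityI subsetI)
  fix p :: "'k mpoly"
  { assume p: "p \<in> mono_span (deg_ge n F 1)"
    then have "p \<in> carrier (poly_ring n)"
      using deg_ge_subset[of n F 1] unfolding carrier_poly_ring mono_span_def by blast
    then show "p \<in> ideal_radical (poly_ring n) (mono_span (deg_ge n F m))"
      using power_in_mono_span_deg_ge[OF p, of m] by (auto simp: ideal_radical_def poly_ring_eq) }
  assume "p \<in> ideal_radical (poly_ring n) (mono_span (deg_ge n F m))"
  then obtain k :: nat where p: "p \<in> mono_span (expvecs n)" "p ^ k \<in> mono_span (deg_ge n F m)"
    by (auto simp: ideal_radical_def poly_ring_eq)
  then have "p ^ k \<in> mono_span (deg_ge n F 1)"
    using deg_ge_antimono[OF assms, of n F] unfolding mono_span_def by blast
  then show "p \<in> mono_span (deg_ge n F 1)"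
  proof (induction k)
    case (Suc k)
    interpret cring "poly_ring n :: 'k mpoly ring" by (rule cring_poly_ring)
    have "p ^ k \<in> carrier (poly_ring n)"
      using nat_pow_closed[of p k] p(1) by (simp add: poly_ring_eq)
    then have "p \<in> mono_span (deg_ge n F 1) \<or> p ^ k \<in> mono_span (deg_ge n F 1)"
      using mono_span_deg_ge_primary[OF p(1), of "p ^ k" F 1] Suc.prems by (auto simp: carrier_poly_ring)
    then show ?case using Suc.IH by blast
  qed simp
qed


section \<open>Localization\<close>

lemma cring_localization:
  assumes "primeideal P (poly_ring n)"
  shows "cring (localization n P :: 'k::field mpoly fract ring)"
  unfolding localization_def
proof (rule cring_subring_on)
  interpret P: primeideal P "poly_ring n" by fact
  let ?C = "carrier (poly_ring n) :: 'k mpoly set"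
  let ?L = "{Fraction_Field.Fract a s | a s. a \<in> ?C \<and> s \<in> ?C - P}"
  have one: "1 \<in> ?C - P"
    using P.I_notcarr P.one_imp_carrier P.one_closed by (auto simp: poly_ring_eq)
  have zero: "0 \<in> P" "0 \<in> ?C"
    using ideal_poly_ringD(2)[OF P.ideal_axioms] by (simp_all add: carrier_poly_ring)
  \<comment> \<open>Adding fractions over a common denominator requires nonzero denominators; this
    holds because 0 lies in \<open>P\<close>.\<close>
  have nz: "s \<noteq> 0" if "s \<in> ?C - P" for s
    using that zero by auto
  have mult: "s * t \<in> ?C - P" if "s \<in> ?C - P" "t \<in> ?C - P" for s t
    using that P.I_prime[of s t] P.m_closed[of s t] by (auto simp: poly_ring_eq)
  have closed: "a + b \<in> ?C" "a * b \<in> ?C" if "a \<in> ?C" "b \<in> ?C" for a b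
    using that P.m_closed[of a b] P.add.m_closed[of a b] by (simp_all add: poly_ring_eq)
  have uminus: "- a \<in> ?C" if "a \<in> ?C" for a
    using that by (simp add: carrier_poly_ring mono_span_def keys_def)
  show "0 \<in> ?L" unfolding Zero_fract_def using zero one by blast
  show "1 \<in> ?L" unfolding One_fract_def using one by blast
  fix x y assume "x \<in> ?L"
  then obtain a s where x: "x = Fraction_Field.Fract a s" "a \<in> ?C" "s \<in> ?C - P" by blast
  have "- x = Fraction_Field.Fract (- a) s" by (simp add: x)
  then show "- x \<in> ?L" using x uminus by blast
  assume "y \<in> ?L"
  then obtain b t where y: "y = Fraction_Field.Fract b t" "b \<in> ?C" "t \<in> ?C - P" by blast
  have "x + y = Fraction_Field.Fract (a * t + b * s) (s * t)"
    using nz[OF x(3)] nz[OF y(3)] by (simp add: x y)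
  moreover have "a * t + b * s \<in> ?C"
    using x y closed by auto
  ultimately show "x + y \<in> ?L" using mult[OF x(3) y(3)] by blast
  have "x * y = Fraction_Field.Fract (a * b) (s * t)"
    by (simp add: x y)
  then show "x * y \<in> ?L" using mult[OF x(3) y(3)] closed[OF x(2) y(2)] by blast
qed

text \<open>The witness makes each monomial of the primary ideal a divisor of an element of
  \<open>J\<close> with cofactor \<open>xpow v\<close> outside the prime, hence a unit in the
  localization. So \<open>J\<close> and the primary ideal have the same extension, and a primary
  ideal is recovered from its extension by contraction.\<close>

lemma loc_contraction_deg_ge:
  fixes J :: "'k::field mpoly set"
  assumes J: "ideal J (poly_ring n)" "J \<subseteq> mono_span (deg_ge n F m)"
    and witness: "\<And>u. u \<in> deg_ge n F m \<Longrightarrow>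
      \<exists>v \<in> expvecs n. deg_on F v = 0 \<and> xpow (u + v) \<in> J"
  shows "loc_contraction n (mono_span (deg_ge n F 1)) J = mono_span (deg_ge n F m)"
proof -
  define P :: "'k mpoly set" where "P = mono_span (deg_ge n F 1)"
  define C :: "'k mpoly set" where "C = mono_span (expvecs n)"
  define Q :: "'k mpoly set" where "Q = mono_span (deg_ge n F m)"
  let ?\<iota> = "\<lambda>g. Fraction_Field.Fract g (1 :: 'k mpoly)"
  let ?L = "{Fraction_Field.Fract a s | a s. a \<in> C \<and> s \<in> C - P}"
  \<comment> \<open>The extension of \<open>Q\<close>, written as the set of fractions with
    numerator in \<open>Q\<close>.\<close>
  let ?K = "{Fraction_Field.Fract g s | g s. g \<in> Q \<and> s \<in> C - P}"
  have prime: "primeideal P (poly_ring n)"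
    unfolding P_def by (rule primeideal_deg_ge)
  interpret L: cring "localization n P" by (rule cring_localization[OF prime])
  have loc: "localization n P = subring_on ?L"
    by (simp add: localization_def carrier_poly_ring C_def)
  have one: "1 \<in> C - P"
    by (simp add: C_def P_def)
  have nz: "s \<noteq> 0" if "s \<in> C - P" for s
    using that by (auto simp: P_def)
  have idealQ: "ideal Q (poly_ring n)"
    unfolding Q_def by (intro ideal_mono_span upset_deg_ge)
  note Qcl = ideal_poly_ringD[OF idealQ, folded C_def]
  have mult: "s * t \<in> C - P" if "s \<in> C - P" "t \<in> C - P" for s t
  proof -
    interpret P: primeideal P "poly_ring n" by (rule prime)
    show ?thesis
      using that P.I_prime[of s t] P.m_closed[of s t] by (auto simp: poly_ring_eq C_def)
  qed
  have J_sub: "?\<iota> ` J \<subseteq> carrier (localization n P)"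
    using one ideal_poly_ringD(1)[OF J(1), folded C_def] unfolding loc subring_on_simps by blast
  have idealK: "ideal ?K (localization n P)"
    unfolding loc
  proof (rule idealI_subring_on)
    show "cring (subring_on ?L)" using L.is_cring by (simp add: loc)
    show "?K \<subseteq> ?L" using Qcl(1) by blast
    show "0 \<in> ?K" unfolding Zero_fract_def using Qcl(2) one by blast
    fix x y assume "x \<in> ?K"
    then obtain a s where x: "x = Fraction_Field.Fract a s" "a \<in> Q" "s \<in> C - P" by blast
    { assume "y \<in> ?K"
      then obtain b t where y: "y = Fraction_Field.Fract b t" "b \<in> Q" "t \<in> C - P" by blast
      have "x + y = Fraction_Field.Fract (a * t + b * s) (s * t)"
        using nz[OF x(3)] nz[OF y(3)] by (simp add: x y)
      moreover have "a * t + b * s \<in> Q"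
        using x y Qcl(3,4) by auto
      ultimately show "x + y \<in> ?K" using mult[OF x(3) y(3)] by blast }
    assume "y \<in> ?L"
    then obtain b t where y: "y = Fraction_Field.Fract b t" "b \<in> C" "t \<in> C - P" by blast
    have "x * y = Fraction_Field.Fract (a * b) (s * t)"
      by (simp add: x y)
    then show "x * y \<in> ?K" using mult[OF x(3) y(3)] Qcl(4)[OF x(2) y(2)] by blast
  qed
  have "?\<iota> ` J \<subseteq> ?K"
    using J(2) one unfolding Q_def by blast
  then have sub: "Idl\<^bsub>localization n P\<^esub> (?\<iota> ` J) \<subseteq> ?K"
    by (rule L.genideal_minimal[OF idealK])
  have "f \<in> Q" if f: "f \<in> C" "?\<iota> f \<in> Idl\<^bsub>localization n P\<^esub> (?\<iota> ` J)" for f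
  proof -
    obtain g s where gs: "?\<iota> f = Fraction_Field.Fract g s" "g \<in> Q" "s \<in> C - P"
      using f(2) sub by blast
    \<comment> \<open>The denominator \<open>s\<close> avoids the prime, so primariness of
      \<open>Q\<close> removes it.\<close>
    then have "f * s = g"
      using nz[OF gs(3)] by (simp add: eq_fract)
    then show ?thesis
      using mono_span_deg_ge_primary[of f n s F m] f(1) gs(2,3) by (simp add: C_def P_def Q_def)
  qed
  moreover have "Q \<subseteq> {f \<in> C. ?\<iota> f \<in> Idl\<^bsub>localization n P\<^esub> (?\<iota> ` J)}" (is "_ \<subseteq> ?M")
    unfolding Q_def
  proof (rule mono_span_subsetI)
    note id = L.genideal_ideal[OF J_sub]
    note cl = ideal_subring_onD[OF id[unfolded loc], folded loc]
    show "0 \<in> ?M" using cl(2) by (simp add: C_def Zero_fract_def)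
    show "x + y \<in> ?M" if "x \<in> ?M" "y \<in> ?M" for x y
      using that cl(3)[of "?\<iota> x" "?\<iota> y"] by (simp add: C_def add_in_mono_span)
    fix u and c :: 'k assume u: "u \<in> deg_ge n F m"
    then obtain v where v: "v \<in> expvecs n" "deg_on F v = 0" "xpow (u + v) \<in> J"
      using witness by blast
    have "Poly_Mapping.single (u + v) c \<in> J"
      unfolding single_eq_xpow_mult[of "u + v" c]
      by (rule ideal_poly_ringD(4)[OF J(1) v(3)]) simp
    then have 1: "?\<iota> (Poly_Mapping.single (u + v) c) \<in> Idl\<^bsub>localization n P\<^esub> (?\<iota> ` J)"
      using L.genideal_self[OF J_sub] by blast
    have xv: "xpow v \<in> C - P"
      using v by (simp add: C_def P_def deg_ge_def)
    then have 2: "Fraction_Field.Fract 1 (xpow v) \<in> ?L"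
      using one by blast
    \<comment> \<open>Dividing by the unit \<open>xpow v\<close> turns a term of \<open>J\<close>
      into the wanted term at \<open>u\<close>.\<close>
    have "?\<iota> (Poly_Mapping.single (u + v) c) * Fraction_Field.Fract 1 (xpow v) = ?\<iota> (Poly_Mapping.single u c)"
      using nz[OF xv] by (simp add: eq_fract) (simp add: xpow_def mult_single)
    then have "?\<iota> (Poly_Mapping.single u c) \<in> Idl\<^bsub>localization n P\<^esub> (?\<iota> ` J)"
      using cl(4)[OF 1 2] by simp
    then show "Poly_Mapping.single u c \<in> ?M"
      using u deg_ge_subset by (auto simp: C_def)
  qed
  ultimately show ?thesis
    unfolding loc_contraction_def carrier_poly_ring
    by (fold C_def P_def Q_def) blast
qed

section \<open>Integer vectors and majorization\<close>

text \<open>Exchange argument with threshold \<open>f j\<close> for \<open>j = card F\<close>: the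
  indices of \<open>{1..j}\<close> outside \<open>F\<close> have values at most \<open>f j\<close>,
  the equally many indices of \<open>F\<close> outside \<open>{1..j}\<close> have values at least
  \<open>f j\<close>.\<close>

lemma sum_prefix_le:
  fixes f :: "nat \<Rightarrow> nat"
  assumes "\<And>x y. 1 \<le> x \<Longrightarrow> x \<le> y \<Longrightarrow> y \<le> n \<Longrightarrow> f x \<le> f y" and F: "F \<subseteq> {1..n}"
  shows "sum f {1..card F} \<le> sum f F"
proof -
  define j where "j = card F"
  have fin: "finite F" using F finite_subset by blast
  have j: "j \<le> n" using card_mono[OF _ F] by (simp add: j_def)
  have eq: "card ({1..j} - F) = card (F - {1..j})"
    using card_Diff_subset_Int[of "{1..j}" F] card_Diff_subset_Int[of F "{1..j}"] fin
    by (simp add: j_def Int_commute)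
  have "sum f ({1..j} - F) \<le> of_nat (card ({1..j} - F)) * f j"
    using assms(1) j by (intro sum_bounded_above) auto
  also have "\<dots> = of_nat (card (F - {1..j})) * f j"
    by (simp only: eq)
  also have "\<dots> \<le> sum f (F - {1..j})"
  \<comment> \<open>Monotonicity starts at index 1 and says nothing about \<open>f 0\<close>, but
    \<open>F\<close> is empty here.\<close>
  proof (cases "j = 0")
    case True
    then show ?thesis using fin by (simp add: j_def)
  next
    case False
    then show ?thesis using assms(1) F by (intro sum_bounded_below) auto
  qed
  finally have "sum f ({1..j} - F) \<le> sum f (F - {1..j})" .
  moreover have "sum f {1..j} = sum f ({1..j} - F) + sum f ({1..j} \<inter> F)"
    using sum.Int_Diff[of "{1..j}" f F] by simp
  moreover have "sum f F = sum f (F - {1..j}) + sum f ({1..j} \<inter> F)"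
    using sum.Int_Diff[OF fin, of f "{1..j}"] by (simp add: Int_commute)
  ultimately show ?thesis by (simp add: j_def)
qed

lemma Pn_mono:
  "u \<in> Pn n \<Longrightarrow> 1 \<le> i \<Longrightarrow> i \<le> j \<Longrightarrow> j \<le> n \<Longrightarrow> Poly_Mapping.lookup u i \<le> Poly_Mapping.lookup u j"
  by (simp add: Pn_def)

lemma Pn_prefix_le:
  assumes "u \<in> Pn n" "F \<subseteq> {1..n}"
  shows "deg_on {1..card F} u \<le> deg_on F u"
  unfolding deg_on_def by (rule sum_prefix_le[OF _ assms(2)]) (rule Pn_mono[OF assms(1)])

text \<open>Sorting the list of indices by their entries, instead of the entries themselves,
  delivers the permutation.\<close>

lemma exists_sorting_permutation:
  assumes "u \<in> expvecs n"
  obtains \<sigma> where "\<sigma> permutes {1..n}" "Poly_Mapping.map_key \<sigma> u \<in> Pn n"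
proof -
  define xs where "xs = sort_key (Poly_Mapping.lookup u) [1..<Suc n]"
  define \<sigma> where "\<sigma> i = (if i \<in> {1..n} then xs ! (i - 1) else i)" for i
  have xs: "distinct xs" "set xs = {1..n}" "length xs = n" "sorted (map (Poly_Mapping.lookup u) xs)"
    by (auto simp: xs_def simp del: upt_Suc)
  have 1: "bij_betw (\<lambda>i. i - 1) {1..n} {..<n}"
    by (rule bij_betwI[of _ _ _ Suc]) auto
  have "bij_betw ((!) xs) {..<n} {1..n}"
    using bij_betw_nth[OF xs(1)] xs(2,3) by blast
  from bij_betw_trans[OF 1 this] have "bij_betw \<sigma> {1..n} {1..n}"
    by (rule bij_betw_cong[THEN iffD1, rotated]) (simp add: \<sigma>_def)
  then have \<sigma>: "\<sigma> permutes {1..n}"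
    by (rule bij_imp_permutes) (simp add: \<sigma>_def del: atLeastAtMost_iff)
  have "Poly_Mapping.lookup u (\<sigma> i) \<le> Poly_Mapping.lookup u (\<sigma> j)"
    if "1 \<le> i" "i \<le> j" "j \<le> n" for i j
    using sorted_nth_mono[OF xs(4), of "i - 1" "j - 1"] that xs(3) by (simp add: \<sigma>_def)
  then have "Poly_Mapping.map_key \<sigma> u \<in> Pn n"
    using assms by (simp add: Pn_def map_key_in_expvecs_iff[OF \<sigma>] lookup_map_key[OF permutes_inj[OF \<sigma>]])
  with \<sigma> show thesis by (rule that)
qed

lemma deg_on_atLeast1_Suc: "deg_on {1..Suc t} u = deg_on {1..t} u + Poly_Mapping.lookup u (Suc t)"
  by (simp add: deg_on_def)

lemma deg_on_prefix:
  assumes "1 \<le> t"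
  shows "deg_on {1..t} u = deg_on {1..t - 1} u + Poly_Mapping.lookup u t"
  using deg_on_atLeast1_Suc[of "t - 1" u] assms by simp

text \<open>Degrees of a shifted vector are computed after adding the removed unit back, since
  \<open>deg_on\<close> is additive while subtraction is truncated.\<close>

lemma move_add_cancel:
  assumes "1 \<le> Poly_Mapping.lookup u j"
  shows "(u + Poly_Mapping.single i 1 - Poly_Mapping.single j 1) + Poly_Mapping.single j 1
           = (u + Poly_Mapping.single i 1 :: nat \<Rightarrow>\<^sub>0 nat)"
  using assms by (intro diff_single_add) (simp add: lookup_add)

lemma lookup_move:
  "Poly_Mapping.lookup (u + Poly_Mapping.single i 1 - Poly_Mapping.single j (1::nat)) x
    = Poly_Mapping.lookup u x + (if x = i then 1 else 0) - (if x = j then 1 else 0)"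
  by (auto simp: lookup_add lookup_minus lookup_single when_def)

lemma move_in_expvecs:
  "u \<in> expvecs n \<Longrightarrow> i \<in> {1..n} \<Longrightarrow> u + Poly_Mapping.single i 1 - v \<in> expvecs n"
  by (intro diff_in_expvecs add_in_expvecs single_in_expvecs)

text \<open>Induction on the total gap between the prefix sums. Each step picks a sorted vector of
  \<open>C\<close> with larger prefix sums that still stay below those of \<open>u\<close>;
  sortedness is kept because \<open>move\<close> applies to sorted vectors only.\<close>

lemma sorted_majorization_closure:
  assumes up: "\<And>u v. u \<in> C \<Longrightarrow> v \<in> expvecs n \<Longrightarrow> u + v \<in> C"
    and move: "\<And>u i j. u \<in> C \<Longrightarrow> u \<in> Pn n \<Longrightarrow> 1 \<le> i \<Longrightarrow> i < j \<Longrightarrow> j \<le> n \<Longrightarrow>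
        Poly_Mapping.lookup u i < Poly_Mapping.lookup u j \<Longrightarrow>
        u + Poly_Mapping.single i 1 - Poly_Mapping.single j 1 \<in> C"
    and u: "u \<in> Pn n"
    and v: "v \<in> C" "v \<in> Pn n"
    and le: "\<And>t. t \<le> n \<Longrightarrow> deg_on {1..t} v \<le> deg_on {1..t} u"
  shows "u \<in> C"
  using v le
proof (induction "(\<Sum>t\<le>n. deg_on {1..t} u) - (\<Sum>t\<le>n. deg_on {1..t} v)" arbitrary: v
    rule: less_induct)
  case (less v)
  note v = less.prems(1,2) and le = less.prems(3)
  let ?u = "Poly_Mapping.lookup u" and ?v = "Poly_Mapping.lookup v"
  show ?case
  proof (cases "\<forall>t\<le>n. deg_on {1..t} v = deg_on {1..t} u")
    case True
    have "?v i = ?u i" for i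
    proof (cases "i \<in> {1..n}")
      case i: True
      then have "deg_on {1..i} v = deg_on {1..i} u" "deg_on {1..i - 1} v = deg_on {1..i - 1} u"
        using True by auto
      then show ?thesis
        using i deg_on_prefix[of i u] deg_on_prefix[of i v] by simp
    next
      case False
      then show ?thesis using u v by (simp add: Pn_def expvecs_iff)
    qed
    then have "v = u" by (rule poly_mapping_eqI)
    then show ?thesis using v by simp
  next
    case False
    \<comment> \<open>At the first gap between the prefix sums the entry of \<open>v\<close> is too
      small and has to be raised.\<close>
    define j where "j = (LEAST t. t \<le> n \<and> deg_on {1..t} v \<noteq> deg_on {1..t} u)"
    have j: "j \<le> n" "deg_on {1..j} v \<noteq> deg_on {1..j} u"
      using False LeastI_ex[of "\<lambda>t. t \<le> n \<and> deg_on {1..t} v \<noteq> deg_on {1..t} u"]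
      unfolding j_def by auto
    then have j_less: "deg_on {1..j} v < deg_on {1..j} u" using le[of j] by simp
    have j1: "1 \<le> j" using j_less by (cases j) (auto simp: deg_on_def)
    have "deg_on {1..j - 1} v = deg_on {1..j - 1} u"
      using not_less_Least[of "j - 1" "\<lambda>t. t \<le> n \<and> deg_on {1..t} v \<noteq> deg_on {1..t} u"] j1 j(1)
      unfolding j_def[symmetric] by simp
    then have vj: "?v j < ?u j"
      using j_less j1 deg_on_prefix[of j u] deg_on_prefix[of j v] by simp
    \<comment> \<open>Raising the last entry of a block of equal values, or lowering the first one, keeps the
      vector sorted.\<close>
    define i where "i = Max {x \<in> {1..n}. ?v x = ?v j}"
    have "i \<in> {x \<in> {1..n}. ?v x = ?v j}"
      unfolding i_def using j j1 by (intro Max_in) auto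
    then have i: "1 \<le> i" "i \<le> n" "?v i = ?v j" by auto
    have ji: "j \<le> i" unfolding i_def using j j1 by (intro Max_ge) auto
    have i_max: "?v i < ?v x" if "i < x" "x \<le> n" for x
    proof -
      have "?v x \<noteq> ?v j"
        using that i Max_ge[of "{x \<in> {1..n}. ?v x = ?v j}" x] unfolding i_def[symmetric] by auto
      moreover have "?v i \<le> ?v x" using that i Pn_mono[OF v(2), of i x] by simp
      ultimately show ?thesis using i by simp
    qed
    have progress: "u \<in> C" if w: "w \<in> C" "w \<in> Pn n" "\<And>t. t \<le> n \<Longrightarrow> deg_on {1..t} w \<le> deg_on {1..t} u"
      "\<And>t. deg_on {1..t} v \<le> deg_on {1..t} w" "deg_on {1..i} v < deg_on {1..i} w" for w
    proof -
      have "(\<Sum>t\<le>n. deg_on {1..t} v) < (\<Sum>t\<le>n. deg_on {1..t} w)"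
        using w(4,5) i by (intro sum_strict_mono_ex1) auto
      moreover have "(\<Sum>t\<le>n. deg_on {1..t} w) \<le> (\<Sum>t\<le>n. deg_on {1..t} u)"
        using w(3) by (intro sum_mono) auto
      ultimately show ?thesis
        using less.hyps[of w] w(1-3) by simp
    qed
    \<comment> \<open>If the prefix sums meet again at some later \<open>t\<close>, the unit has to
      be taken from the block of \<open>t\<close>; otherwise a new unit may be added.\<close>
    show ?thesis
    proof (cases "\<exists>t. j < t \<and> t \<le> n \<and> deg_on {1..t} v = deg_on {1..t} u")
      case True
      define t where "t = (LEAST t. j < t \<and> t \<le> n \<and> deg_on {1..t} v = deg_on {1..t} u)"
      have t: "j < t" "t \<le> n" "deg_on {1..t} v = deg_on {1..t} u"
        using LeastI_ex[OF True] unfolding t_def by auto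
      have t_least: "deg_on {1..x} v < deg_on {1..x} u" if "j \<le> x" "x < t" for x
      proof (cases "x = j")
        case False
        then have "deg_on {1..x} v \<noteq> deg_on {1..x} u"
          using not_less_Least[of x "\<lambda>t. j < t \<and> t \<le> n \<and> deg_on {1..t} v = deg_on {1..t} u"] that t(2)
          unfolding t_def[symmetric] by simp
        then show ?thesis using le[of x] that t(2) by simp
      qed (use j_less in simp)
      have "deg_on {1..t - 1} v < deg_on {1..t - 1} u"
        using t_least[of "t - 1"] t(1) by simp
      then have "?u t < ?v t"
        using t(1,3) deg_on_prefix[of t u] deg_on_prefix[of t v] by linarith
      moreover have "?u j \<le> ?u t" using Pn_mono[OF u, of j t] t j1 by simp
      ultimately have vt: "?v j + 2 \<le> ?v t" using vj by simp
      define s where "s = Min {x \<in> {1..n}. ?v x = ?v t}"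
      have "s \<in> {x \<in> {1..n}. ?v x = ?v t}"
        unfolding s_def using t by (intro Min_in) auto
      then have s: "1 \<le> s" "s \<le> n" "?v s = ?v t" by auto
      have st: "s \<le> t" unfolding s_def using t by (intro Min_le) auto
      have s_min: "?v x < ?v s" if "1 \<le> x" "x < s" for x
      proof -
        have "?v x \<noteq> ?v t"
          using that s Min_le[of "{x \<in> {1..n}. ?v x = ?v t}" x] unfolding s_def[symmetric] by auto
        moreover have "?v x \<le> ?v s" using that s Pn_mono[OF v(2), of x s] by simp
        ultimately show ?thesis using s by simp
      qed
      have "i < s"
      proof (rule ccontr)
        assume "\<not> i < s"
        then have "?v s \<le> ?v i" using Pn_mono[OF v(2), of s i] i s by simp
        then show False using i s vt by simp
      qed
      let ?w = "v + Poly_Mapping.single i 1 - Poly_Mapping.single s 1"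
      \<comment> \<open>Only the prefixes with \<open>i \<le> x < s\<close> grow. They satisfy
        \<open>j \<le> x < t\<close>, where the gap is strict.\<close>
      have deg_w: "deg_on {1..x} ?w = deg_on {1..x} v + (if i \<le> x \<and> x < s then 1 else 0)" for x
      proof -
        have "1 \<le> ?v s" using s vt by simp
        from arg_cong[OF move_add_cancel[OF this, of i], of "deg_on {1..x}"] show ?thesis
          unfolding deg_on_add using i s \<open>i < s\<close> by (auto split: if_splits)
      qed
      show ?thesis
      proof (rule progress[of ?w])
        show "?w \<in> C" using v i s vt \<open>i < s\<close> by (intro move) auto
        have "Poly_Mapping.lookup ?w x \<le> Poly_Mapping.lookup ?w y" if "1 \<le> x" "x \<le> y" "y \<le> n" for x y
        proof (cases "x = y")
          case False
          then show ?thesis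
            unfolding lookup_move
            using that Pn_mono[OF v(2), of x y] i_max[of y] s_min[of x] i s vt by auto
        qed simp
        moreover have "?w \<in> expvecs n"
          using v i by (intro move_in_expvecs) (auto simp: Pn_def)
        ultimately show "?w \<in> Pn n" by (simp add: Pn_def)
        show "deg_on {1..x} ?w \<le> deg_on {1..x} u" if "x \<le> n" for x
          using deg_w[of x] le[OF that] t_least[of x] ji st by auto
      qed (use deg_w \<open>i < s\<close> in auto)
    next
      case False
      let ?w = "v + Poly_Mapping.single i 1"
      have deg_w: "deg_on {1..x} ?w = deg_on {1..x} v + (if i \<le> x then 1 else 0)" for x
        using i by (simp add: deg_on_add)
      show ?thesis
      proof (rule progress[of ?w])
        show "?w \<in> C" using v i by (intro up single_in_expvecs) auto
        have "Poly_Mapping.lookup ?w x \<le> Poly_Mapping.lookup ?w y" if "1 \<le> x" "x \<le> y" "y \<le> n" for x y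
          using that Pn_mono[OF v(2), of x y] i_max[of y]
          by (cases "x = y") (auto simp: lookup_add lookup_single when_def)
        moreover have "?w \<in> expvecs n"
          using v i by (intro add_in_expvecs single_in_expvecs) (auto simp: Pn_def)
        ultimately show "?w \<in> Pn n" by (simp add: Pn_def)
        \<comment> \<open>There is no equality from \<open>j\<close> on, so each prefix containing
          \<open>i\<close> has room for one more unit.\<close>
        show "deg_on {1..x} ?w \<le> deg_on {1..x} u" if "x \<le> n" for x
        proof (cases "i \<le> x")
          case True
          then have "deg_on {1..x} v \<noteq> deg_on {1..x} u"
            using False j(2) ji that by (cases "x = j") auto
          then show ?thesis using deg_w[of x] le[OF that] by simp
        qed (use deg_w[of x] le[OF that] in simp)
      qed (use deg_w in auto)
    qed
  qed
qed

lemma majorization_closure: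
  assumes up: "\<And>u v. u \<in> C \<Longrightarrow> v \<in> expvecs n \<Longrightarrow> u + v \<in> C"
    and perm: "\<And>u \<sigma>. u \<in> C \<Longrightarrow> \<sigma> permutes {1..n} \<Longrightarrow> Poly_Mapping.map_key \<sigma> u \<in> C"
    and move: "\<And>u i j. u \<in> C \<Longrightarrow> u \<in> Pn n \<Longrightarrow> 1 \<le> i \<Longrightarrow> i < j \<Longrightarrow> j \<le> n \<Longrightarrow>
        Poly_Mapping.lookup u i < Poly_Mapping.lookup u j \<Longrightarrow>
        u + Poly_Mapping.single i 1 - Poly_Mapping.single j 1 \<in> C"
    and l: "l \<in> C" "l \<in> Pn n"
    and u: "u \<in> expvecs n" "\<And>F. F \<subseteq> {1..n} \<Longrightarrow> deg_on {1..card F} l \<le> deg_on F u"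
  shows "u \<in> C"
proof -
  obtain \<sigma> where \<sigma>: "\<sigma> permutes {1..n}" "Poly_Mapping.map_key \<sigma> u \<in> Pn n"
    using exists_sorting_permutation[OF u(1)] .
  have "Poly_Mapping.map_key \<sigma> u \<in> C"
  proof (rule sorted_majorization_closure[OF up move \<sigma>(2) l])
    fix t assume "t \<le> n"
    then have "\<sigma> ` {1..t} \<subseteq> {1..n}"
      using permutes_in_image[OF \<sigma>(1)] by fastforce
    from u(2)[OF this] show "deg_on {1..t} l \<le> deg_on {1..t} (Poly_Mapping.map_key \<sigma> u)"
      by (simp add: card_image[OF permutes_inj_on[OF \<sigma>(1)]] deg_on_map_key[OF permutes_inj[OF \<sigma>(1)]])
  qed
  from perm[OF this permutes_inv[OF \<sigma>(1)]] show ?thesis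
    by (simp add: map_key_inverse(1)[OF permutes_bij[OF \<sigma>(1)]])
qed

text \<open>For \<open>b 0 = 0\<close> these are the exponents of the intersection of the symbolic
  powers \<open>sym_power n j (b j)\<close>. With \<open>b\<close> left arbitrary, one notion covers
  both the ideal and its powers.\<close>

definition card_bounded :: "nat \<Rightarrow> (nat \<Rightarrow> nat) \<Rightarrow> (nat \<Rightarrow>\<^sub>0 nat) set" where
  "card_bounded n b = {u \<in> expvecs n. \<forall>F \<subseteq> {1..n}. b (card F) \<le> deg_on F u}"

lemma upset_card_bounded: "upset n (card_bounded n b)"
  by (auto simp: upset_def card_bounded_def add_in_expvecs deg_on_add trans_le_add1)

lemma card_bounded_perm:
  assumes "\<sigma> permutes {1..n}"
  shows "Poly_Mapping.map_key \<sigma> -` card_bounded n b = card_bounded n b"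
proof -
  have "(\<forall>F \<subseteq> {1..n}. b (card F) \<le> deg_on (\<sigma> ` F) u) \<longleftrightarrow> (\<forall>F \<subseteq> {1..n}. b (card F) \<le> deg_on F u)" for u
  proof -
    have "(\<forall>F \<in> Pow {1..n}. b (card F) \<le> deg_on F u)
        \<longleftrightarrow> (\<forall>F \<in> image \<sigma> ` Pow {1..n}. b (card F) \<le> deg_on F u)"
      by (simp only: image_Pow_surj[OF permutes_image[OF assms]])
    then show ?thesis
      by (simp add: Pow_def card_image[OF permutes_inj_on[OF assms]])
  qed
  then show ?thesis
    by (auto simp: card_bounded_def map_key_in_expvecs_iff[OF assms] deg_on_map_key[OF permutes_inj[OF assms]])
qed

text \<open>Only a set \<open>F\<close> with \<open>j\<close> but without \<open>i\<close> loses a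
  unit. Replacing \<open>j\<close> by \<open>i\<close> gives a set of the same size and of strictly
  smaller degree, so the bound for that set leaves a spare unit on \<open>F\<close>.\<close>

lemma card_bounded_move:
  assumes u: "u \<in> card_bounded n b" and ij: "i \<in> {1..n}" "j \<in> {1..n}"
    and less: "Poly_Mapping.lookup u i < Poly_Mapping.lookup u j"
  shows "u + Poly_Mapping.single i 1 - Poly_Mapping.single j 1 \<in> card_bounded n b" (is "?w \<in> _")
proof -
  have bound: "b (card F) \<le> deg_on F u" if "F \<subseteq> {1..n}" for F
    using u that by (simp add: card_bounded_def)
  have "b (card F) \<le> deg_on F ?w" if F: "F \<subseteq> {1..n}" for F
  proof -
    have fin: "finite F" using F finite_subset by blast
    have "1 \<le> Poly_Mapping.lookup u j" using less by simp
    from arg_cong[OF move_add_cancel[OF this, of i], of "deg_on F"]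
    have eq: "deg_on F ?w + (if j \<in> F then 1 else 0) = deg_on F u + (if i \<in> F then 1 else 0)"
      unfolding deg_on_add deg_on_single[OF fin] .
    have bF: "b (card F) \<le> deg_on F u" using bound F .
    show ?thesis
    proof (cases "j \<in> F \<and> i \<notin> F")
      case True
      have "card (insert i (F - {j})) = Suc (card (F - {j}))"
        using True fin by (intro card_insert_disjoint) auto
      then have "card (insert i (F - {j})) = card F"
        using True fin card_Suc_Diff1[of F j] by metis
      moreover have "insert i (F - {j}) \<subseteq> {1..n}"
        using F ij by blast
      ultimately have "b (card F) \<le> deg_on (insert i (F - {j})) u"
        using bound by metis
      moreover have "deg_on (insert i (F - {j})) u = Poly_Mapping.lookup u i + deg_on (F - {j}) u"
        unfolding deg_on_def using True fin by (intro sum.insert) auto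
      moreover have "deg_on F u = Poly_Mapping.lookup u j + deg_on (F - {j}) u"
        unfolding deg_on_def using True fin by (intro sum.remove) auto
      ultimately show ?thesis using eq True less by simp
    qed (use eq bF in \<open>auto split: if_splits\<close>)
  qed
  then show ?thesis
    using u move_in_expvecs[OF _ ij(1)] by (simp add: card_bounded_def)
qed

text \<open>If a sum has a smaller entry at \<open>i\<close> than at \<open>j\<close>, so does one
  of its summands, and the shift is carried out there. The assumption on \<open>U\<close> concerns
  unsorted vectors too, because nothing is known about the order within that summand.\<close>

lemma nfold_sums_move:
  assumes U: "\<And>u. u \<in> U \<Longrightarrow> Poly_Mapping.lookup u i < Poly_Mapping.lookup u j \<Longrightarrow>
      u + Poly_Mapping.single i 1 - Poly_Mapping.single j 1 \<in> U"
    and i: "i \<in> {1..n}"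
  shows "u \<in> nfold_sums n U k \<Longrightarrow> Poly_Mapping.lookup u i < Poly_Mapping.lookup u j \<Longrightarrow>
      u + Poly_Mapping.single i 1 - Poly_Mapping.single j 1 \<in> nfold_sums n U k"
proof (induction k arbitrary: u)
  case 0
  then show ?case using move_in_expvecs[OF _ i] by simp
next
  case (Suc k)
  let ?e = "Poly_Mapping.single i (1::nat)" and ?f = "Poly_Mapping.single j (1::nat)"
  obtain x y where u: "u = x + y" "x \<in> nfold_sums n U k" "y \<in> U"
    using Suc.prems by auto
  then consider "Poly_Mapping.lookup x i < Poly_Mapping.lookup x j"
    | "Poly_Mapping.lookup y i < Poly_Mapping.lookup y j"
    using Suc.prems(2) by (force simp: lookup_add)
  then show ?case
  proof cases
    case 1
    have "u + ?e - ?f = (x + ?e - ?f) + y"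
      using 1 by (intro poly_mapping_eqI) (auto simp: u lookup_add lookup_minus lookup_single when_def)
    then show ?thesis using Suc.IH[OF u(2) 1] u(3) by auto
  next
    case 2
    have "u + ?e - ?f = x + (y + ?e - ?f)"
      using 2 by (intro poly_mapping_eqI) (auto simp: u lookup_add lookup_minus lookup_single when_def)
    then show ?thesis using U[OF u(3) 2] u(2) by auto
  qed
qed

lemma nfold_sums_perm:
  assumes U: "\<And>u. u \<in> U \<Longrightarrow> Poly_Mapping.map_key \<sigma> u \<in> U" and \<sigma>: "\<sigma> permutes {1..n}"
  shows "u \<in> nfold_sums n U k \<Longrightarrow> Poly_Mapping.map_key \<sigma> u \<in> nfold_sums n U k"
proof (induction k arbitrary: u)
  case 0
  then show ?case by (simp add: map_key_in_expvecs_iff[OF \<sigma>])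
next
  case (Suc k)
  then obtain x y where u: "u = x + y" "x \<in> nfold_sums n U k" "y \<in> U"
    by auto
  then show ?case using Suc.IH[OF u(2)] U[OF u(3)] by (auto simp: map_key_plus[OF permutes_inj[OF \<sigma>]])
qed

text \<open>Supplies the vector \<open>k \<cdot> l\<close>, described by its entries, from which
  paths inside the set of sums start.\<close>

lemma multiple_in_nfold_sums:
  assumes "l \<in> U"
  shows "\<exists>m \<in> nfold_sums n U k. \<forall>i. Poly_Mapping.lookup m i = k * Poly_Mapping.lookup l i"
proof (induction k)
  case 0
  show ?case by (intro bexI[of _ 0]) simp_all
next
  case (Suc k)
  then obtain m where "m \<in> nfold_sums n U k" "\<forall>i. Poly_Mapping.lookup m i = k * Poly_Mapping.lookup l i"
    by blast
  then show ?case using assms by (intro bexI[of _ "m + l"]) (auto simp: lookup_add)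
qed

lemma in_card_bounded_prefix:
  assumes "l \<in> Pn n"
  shows "l \<in> card_bounded n (\<lambda>t. deg_on {1..t} l)"
  using Pn_prefix_le[OF assms] assms by (simp add: card_bounded_def Pn_def)

text \<open>A shift of a sum can always be realised on one of its summands, so the set of sums inherits the
  closure properties which generate all of the right-hand side from \<open>k \<cdot> l\<close>.\<close>

lemma nfold_sums_card_bounded:
  assumes l: "l \<in> Pn n"
  shows "nfold_sums n (card_bounded n (\<lambda>t. deg_on {1..t} l)) k
           = card_bounded n (\<lambda>t. k * deg_on {1..t} l)" (is "nfold_sums n ?U k = _")
proof (intro equalityI subsetI)
  fix u assume "u \<in> nfold_sums n ?U k"
  then show "u \<in> card_bounded n (\<lambda>t. k * deg_on {1..t} l)"
  proof (induction k arbitrary: u)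
    case 0
    then show ?case by (simp add: card_bounded_def)
  next
    case (Suc k)
    then obtain x y where "u = x + y" "x \<in> card_bounded n (\<lambda>t. k * deg_on {1..t} l)" "y \<in> ?U"
      by auto
    moreover have "Suc k * deg_on {1..t} l = k * deg_on {1..t} l + deg_on {1..t} l" for t
      by simp
    ultimately show ?case
      by (auto simp: card_bounded_def deg_on_add add_in_expvecs simp del: mult_Suc intro!: add_mono)
  qed
next
  fix u assume u: "u \<in> card_bounded n (\<lambda>t. k * deg_on {1..t} l)"
  obtain m where m: "m \<in> nfold_sums n ?U k" "\<And>i. Poly_Mapping.lookup m i = k * Poly_Mapping.lookup l i"
    using multiple_in_nfold_sums[OF in_card_bounded_prefix[OF l]] by blast
  have deg_m: "deg_on F m = k * deg_on F l" for F
    by (simp add: deg_on_def m sum_distrib_left)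
  show "u \<in> nfold_sums n ?U k"
  proof (rule majorization_closure)
    show "m \<in> Pn n" using l by (simp add: Pn_def expvecs_iff m)
    show "x + y \<in> nfold_sums n ?U k" if "x \<in> nfold_sums n ?U k" "y \<in> expvecs n" for x y
      by (rule upsetD[OF upset_nfold_sums[OF upset_card_bounded] that])
    show "Poly_Mapping.map_key \<sigma> x \<in> nfold_sums n ?U k"
      if "x \<in> nfold_sums n ?U k" "\<sigma> permutes {1..n}" for x \<sigma>
      using card_bounded_perm[OF that(2), of "\<lambda>t. deg_on {1..t} l"]
      by (intro nfold_sums_perm[OF _ that(2,1)]) blast
    show "x + Poly_Mapping.single i 1 - Poly_Mapping.single j 1 \<in> nfold_sums n ?U k"
      if "x \<in> nfold_sums n ?U k" "1 \<le> i" "i < j" "j \<le> n"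
        "Poly_Mapping.lookup x i < Poly_Mapping.lookup x j" for x i j
      using that by (intro nfold_sums_move card_bounded_move) auto
  qed (use m u in \<open>auto simp: deg_m card_bounded_def\<close>)
qed

section \<open>The ideal Sss as the span of a cardinality-bounded set\<close>

lemma perm_poly_mono_span_card_bounded:
  assumes "\<sigma> permutes {1..n}"
  shows "perm_poly \<sigma> ` mono_span (card_bounded n b) = mono_span (card_bounded n b)"
  by (simp only: perm_poly_mono_span[OF permutes_bij[OF assms]] card_bounded_perm[OF assms])

lemma sym_strongly_shifted_card_bounded:
  "sym_strongly_shifted n (mono_span (card_bounded n b) :: 'k::field mpoly set)"
  unfolding sym_strongly_shifted_def sym_monomial_ideal_def monomial_ideal_def
proof (intro conjI exI allI impI ballI)
  show "card_bounded n b \<subseteq> expvecs n"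
    by (rule upset_subset[OF upset_card_bounded])
  show "(mono_span (card_bounded n b) :: 'k mpoly set) = Idl\<^bsub>poly_ring n\<^esub> (xpow ` card_bounded n b)"
    by (simp add: genideal_xpow_upset[OF upset_card_bounded])
  fix u :: "nat \<Rightarrow>\<^sub>0 nat" and i j
  assume "u \<in> P_of n (mono_span (card_bounded n b) :: 'k mpoly set)"
    "1 \<le> i \<and> i < j \<and> j \<le> n \<and> Poly_Mapping.lookup u i < Poly_Mapping.lookup u j"
  then show "xpow (u + Poly_Mapping.single i 1 - Poly_Mapping.single j 1) \<in> (mono_span (card_bounded n b) :: 'k mpoly set)"
    unfolding xpow_in_mono_span by (intro card_bounded_move) (auto simp: P_of_def)
qed (simp add: perm_poly_mono_span_card_bounded)

lemma perm_poly_xpow: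
  assumes "bij \<sigma>"
  shows "perm_poly \<sigma> (xpow (Poly_Mapping.map_key \<sigma> u)) = xpow u"
  by (simp add: perm_poly_def xpow_def map_key_single[OF bij_is_inj[OF bij_map_key[OF assms]]])

text \<open>The right-hand side is itself symmetric strongly shifted and contains
  \<open>xpow l\<close>. Conversely, the exponents of any such ideal satisfy the closure conditions
  of \<open>majorization_closure\<close>, starting from \<open>l\<close>.\<close>

lemma Sss_eq:
  assumes l: "l \<in> Pn n"
  shows "Sss n {l} = (mono_span (card_bounded n (\<lambda>t. deg_on {1..t} l)) :: 'k::field mpoly set)"
    (is "_ = mono_span ?U")
proof
  show "Sss n {l} \<subseteq> (mono_span ?U :: 'k mpoly set)"
    unfolding Sss_def
    by (intro Inter_lower CollectI conjI sym_strongly_shifted_card_bounded)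
      (simp add: in_card_bounded_prefix[OF l, simplified])
  have "mono_span ?U \<subseteq> J" if J: "sym_strongly_shifted n J" "xpow l \<in> J" for J :: "'k mpoly set"
  proof -
    obtain S where S: "S \<subseteq> expvecs n" "J = Idl\<^bsub>poly_ring n\<^esub> (xpow ` S)"
      using J(1) unfolding sym_strongly_shifted_def sym_monomial_ideal_def monomial_ideal_def by blast
    define V where "V = {u + v | u v. u \<in> S \<and> v \<in> expvecs n}"
    have V: "J = mono_span V"
      unfolding V_def S(2) by (rule genideal_xpow[OF S(1)])
    have "u \<in> V" if u: "u \<in> ?U" for u
    proof (rule majorization_closure[where l = l])
      show "x + y \<in> V" if xy: "x \<in> V" "y \<in> expvecs n" for x y
      proof -
        obtain s w where "x = s + w" "s \<in> S" "w \<in> expvecs n"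
          using xy(1) unfolding V_def by blast
        then have "x + y = s + (w + y)" "s \<in> S" "w + y \<in> expvecs n"
          using xy(2) by (simp_all add: add.assoc add_in_expvecs)
        then show ?thesis unfolding V_def by blast
      qed
      show "Poly_Mapping.map_key \<sigma> x \<in> V" if x: "x \<in> V" and \<sigma>: "\<sigma> permutes {1..n}" for x \<sigma>
      proof -
        \<comment> \<open>\<open>perm_poly \<sigma>\<close> undoes \<open>map_key \<sigma>\<close>
          on monomials, so the inverse permutation is the one that sends \<open>x\<close> to
          \<open>map_key \<sigma> x\<close>.\<close>
        have "perm_poly (inv_into UNIV \<sigma>) ` J = J"
          using J(1) permutes_inv[OF \<sigma>] unfolding sym_strongly_shifted_def sym_monomial_ideal_def by blast
        moreover have "xpow x \<in> J" using x V by simp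
        ultimately have "perm_poly (inv_into UNIV \<sigma>) (xpow x) \<in> J" by blast
        moreover have "perm_poly (inv_into UNIV \<sigma>) (xpow x) = (xpow (Poly_Mapping.map_key \<sigma> x) :: 'k mpoly)"
          using perm_poly_xpow[OF bij_imp_bij_inv[OF permutes_bij[OF \<sigma>]], of "Poly_Mapping.map_key \<sigma> x"]
          by (simp add: map_key_inverse(1)[OF permutes_bij[OF \<sigma>]])
        ultimately show ?thesis by (simp add: V)
      qed
      show "x + Poly_Mapping.single i 1 - Poly_Mapping.single j 1 \<in> V"
        if "x \<in> V" "x \<in> Pn n" "1 \<le> i" "i < j" "j \<le> n"
          "Poly_Mapping.lookup x i < Poly_Mapping.lookup x j" for x i j
      proof -
        have "x \<in> P_of n J" using that V by (simp add: P_of_def)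
        then have "xpow (x + Poly_Mapping.single i 1 - Poly_Mapping.single j 1) \<in> J"
          using J(1) that unfolding sym_strongly_shifted_def by blast
        then show ?thesis by (simp add: V)
      qed
    qed (use u l J(2) V in \<open>auto simp: card_bounded_def\<close>)
    then show ?thesis by (simp add: V subsetI)
  qed
  then show "mono_span ?U \<subseteq> (Sss n {l} :: 'k mpoly set)"
    unfolding Sss_def by (intro Inter_greatest) simp
qed

section \<open>Irredundant components\<close>

lemma exists_bad_exponent:
  fixes w b :: "nat \<Rightarrow> nat"
  assumes j: "1 \<le> j" "j \<le> n"
    and b: "\<And>s t. s \<le> t \<Longrightarrow> t \<le> n \<Longrightarrow> b s \<le> b t"
    and w_mono: "\<And>x y. 1 \<le> x \<Longrightarrow> x \<le> y \<Longrightarrow> y \<le> j \<Longrightarrow> w x \<le> w y"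
    and prefix: "\<And>t. t < j \<Longrightarrow> b t \<le> sum w {1..t}" and total: "sum w {1..j} < b j"
  obtains u where "u \<in> expvecs n" "deg_on {1..j} u < b j"
    "\<And>G. G \<subseteq> {1..n} \<Longrightarrow> G \<noteq> {1..j} \<Longrightarrow> b (card G) \<le> deg_on G u"
proof -
  \<comment> \<open>Since \<open>b\<close> increases up to \<open>n\<close>, one entry
    \<open>b n\<close> outside \<open>{1..j}\<close> satisfies the bound of every set containing its
    index. Only subsets of \<open>{1..j}\<close> remain, and there prefixes have the least
    degree.\<close>
  define f where "f i = (if i \<in> {1..j} then w i else if i \<in> {1..n} then b n else 0)" for i
  have "{i. f i \<noteq> 0} \<subseteq> {1..n}" using j by (auto simp: f_def)
  then have fin: "finite {i. f i \<noteq> 0}" by (rule finite_subset) simp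
  define u where "u = Poly_Mapping.Abs_poly_mapping f"
  have lookup_u: "Poly_Mapping.lookup u = f"
    unfolding u_def by (rule lookup_Abs_poly_mapping[OF fin])
  have u: "u \<in> expvecs n" using j by (simp add: expvecs_iff lookup_u f_def)
  have deg_u: "deg_on G u = sum w G" if "G \<subseteq> {1..j}" for G
    unfolding deg_on_def lookup_u using that by (intro sum.cong) (auto simp: f_def)
  have "b (card G) \<le> deg_on G u" if G: "G \<subseteq> {1..n}" "G \<noteq> {1..j}" for G
  proof (cases "G \<subseteq> {1..j}")
    case True
    then have "card G < j"
      using G(2) psubset_card_mono[of "{1..j}" G] by auto
    then show ?thesis
      using prefix[of "card G"] sum_prefix_le[of j w G, OF w_mono True] deg_u[OF True] by simp
  next
    case False
    then obtain i where i: "i \<in> G" "i \<notin> {1..j}" by blast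
    have "card G \<le> n" using card_mono[OF _ G(1)] by simp
    then have "b (card G) \<le> f i"
      using b[of "card G" n] i G(1) by (auto simp: f_def)
    also have "\<dots> \<le> deg_on G u"
      unfolding deg_on_def lookup_u using i G(1) finite_subset by (intro member_le_sum) auto
    finally show ?thesis .
  qed
  moreover have "deg_on {1..j} u < b j" using total by (simp add: deg_u)
  ultimately show thesis using u that by blast
qed

lemma deg_on_prefix_mono: "s \<le> t \<Longrightarrow> deg_on {1..s} u \<le> deg_on {1..t} u"
  unfolding deg_on_def by (intro sum_mono2) auto

text \<open>The vector violates the bound of the single set \<open>{1..j}\<close>, not of the other
  sets of size \<open>j\<close>. Hence it detects the symbolic power as a component and also, after
  a permutation, every single primary component.\<close>

definition nonredundant_at :: "nat \<Rightarrow> (nat \<Rightarrow> nat) \<Rightarrow> nat \<Rightarrow> bool" where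
  "nonredundant_at n b j \<longleftrightarrow> (\<exists>u \<in> expvecs n. deg_on {1..j} u < b j \<and>
     (\<forall>G \<subseteq> {1..n}. G \<noteq> {1..j} \<longrightarrow> b (card G) \<le> deg_on G u))"

lemma nonredundant_atI:
  assumes j: "1 \<le> j" "j \<le> n"
    and w_mono: "\<And>x y. 1 \<le> x \<Longrightarrow> x \<le> y \<Longrightarrow> y \<le> j \<Longrightarrow> w x \<le> w y"
    and prefix: "\<And>t. t < j \<Longrightarrow> k * deg_on {1..t} l \<le> sum w {1..t}"
    and total: "sum w {1..j} < k * deg_on {1..j} l"
  shows "nonredundant_at n (\<lambda>t. k * deg_on {1..t} l) j"
proof -
  obtain u where "u \<in> expvecs n" "deg_on {1..j} u < k * deg_on {1..j} l"
    "\<And>G. G \<subseteq> {1..n} \<Longrightarrow> G \<noteq> {1..j} \<Longrightarrow> k * deg_on {1..card G} l \<le> deg_on G u"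
    by (rule exists_bad_exponent[of j n "\<lambda>t. k * deg_on {1..t} l" w])
      (use assms deg_on_prefix_mono in auto)
  then show ?thesis unfolding nonredundant_at_def by blast
qed

text \<open>All bounds for smaller sets vanish, so zero entries on \<open>{1..j}\<close> serve as
  witness.\<close>

lemma nonredundant_at_first:
  assumes "1 \<le> j" "j \<le> n" "1 \<le> k" "\<And>t. t < j \<Longrightarrow> deg_on {1..t} l = 0" "0 < deg_on {1..j} l"
  shows "nonredundant_at n (\<lambda>t. k * deg_on {1..t} l) j"
  by (rule nonredundant_atI[where w = "\<lambda>_. 0"]) (use assms in auto)

text \<open>The witness is \<open>k \<cdot> l\<close> with its entry at \<open>j\<close> lowered by
  one; the jump leaves room for this without destroying the order.\<close>

lemma nonredundant_at_jump:
  assumes l: "l \<in> Pn n" and j: "2 \<le> j" "j \<le> n" and k: "1 \<le> k"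
    and jump: "Poly_Mapping.lookup l (j - 1) < Poly_Mapping.lookup l j"
  shows "nonredundant_at n (\<lambda>t. k * deg_on {1..t} l) j"
proof -
  let ?l = "Poly_Mapping.lookup l"
  define w where "w i = (if i = j then k * ?l j - 1 else k * ?l i)" for i
  have w_sum: "sum w {1..t} = k * deg_on {1..t} l" if "t < j" for t
    unfolding deg_on_def sum_distrib_left using that by (intro sum.cong) (auto simp: w_def)
  have pos: "k * ?l (j - 1) < k * ?l j" using jump k by simp
  show ?thesis
  proof (rule nonredundant_atI[where w = w])
    fix x y assume xy: "1 \<le> x" "x \<le> y" "y \<le> j"
    show "w x \<le> w y"
    proof (cases "y = j \<and> x < j")
      case True
      then have "x \<le> j - 1" by linarith
      then have "k * ?l x \<le> k * ?l (j - 1)"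
        using Pn_mono[OF l, of x "j - 1"] xy j by (intro mult_le_mono2) simp
      then have "k * ?l x \<le> k * ?l j - 1" using pos by linarith
      then show ?thesis using True by (simp add: w_def)
    next
      case False
      then show ?thesis using xy j Pn_mono[OF l, of x y] by (auto simp: w_def)
    qed
  next
    obtain i where i: "j = Suc i" using j by (cases j) auto
    have "sum w {1..j} = sum w {1..j - 1} + w j" by (simp add: i)
    also have "\<dots> = k * deg_on {1..j - 1} l + (k * ?l j - 1)"
      using w_sum[of "j - 1"] j by (simp add: w_def)
    also have "\<dots> < k * deg_on {1..j - 1} l + k * ?l j" using pos by simp
    also have "\<dots> = k * deg_on {1..j} l"
      using deg_on_prefix[of j l] j by (simp add: distrib_left)
    finally show "sum w {1..j} < k * deg_on {1..j} l" .
  qed (use j w_sum in auto)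
qed

text \<open>The witness distributes the degree \<open>k a\<^sub>j\<^sub>-\<^sub>1\<close> as evenly as possible over the
  first \<open>j - 1\<close> entries, which makes all shorter prefix sums as large as possible.\<close>

lemma nonredundant_at_balanced:
  assumes l: "l \<in> Pn n" and j: "2 \<le> j" "j \<le> n"
    and qr: "k * deg_on {1..j - 1} l = (j - 1) * q + r" "r \<le> j - 2"
    and big: "q + 2 \<le> k * Poly_Mapping.lookup l j"
  shows "nonredundant_at n (\<lambda>t. k * deg_on {1..t} l) j"
proof -
  let ?l = "Poly_Mapping.lookup l"
  \<comment> \<open>The last \<open>r\<close> of the first \<open>j - 1\<close> positions receive
    \<open>q + 1\<close>; the entry at \<open>j\<close> makes the total one less than the
    bound.\<close>
  define w where "w i = (if i = j then k * ?l j - 1 else if j \<le> i + r then q + 1 else q)" for i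
  \<comment> \<open>\<open>t + r + 1 - j\<close>, truncated at 0, counts the raised positions up to
    \<open>t\<close>.\<close>
  have w_sum: "sum w {1..t} = t * q + (t + r + 1 - j)" if "t < j" for t
    using that
  proof (induction t)
    case 0
    then show ?case using qr(2) j by simp
  next
    case (Suc t)
    then show ?case by (auto simp: w_def)
  qed
  show ?thesis
  proof (rule nonredundant_atI[where w = w])
    \<comment> \<open>\<open>big\<close> says that the last entry \<open>k * ?l j - 1\<close> is at
      least \<open>q + 1\<close>.\<close>
    show "w x \<le> w y" if "1 \<le> x" "x \<le> y" "y \<le> j" for x y
      using that big by (auto simp: w_def)
  next
    fix t assume t: "t < j"
    \<comment> \<open>Either the first \<open>t\<close> entries of \<open>k \<cdot> l\<close> are at
      most \<open>q\<close>, or the entries from \<open>t + 1\<close> to \<open>j - 1\<close> are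
      all at least \<open>q + 1\<close> and leave at most \<open>t * q + r - (j - 1 - t)\<close> for
      the prefix.\<close>
    show "k * deg_on {1..t} l \<le> sum w {1..t}"
    proof (cases "k * ?l t \<le> q \<or> t = 0")
      case True
      have "deg_on {1..t} l \<le> t * ?l t"
        unfolding deg_on_def
        using sum_bounded_above[of "{1..t}" ?l "?l t"] Pn_mono[OF l] t j by simp
      then have "k * deg_on {1..t} l \<le> k * (t * ?l t)" by (rule mult_le_mono2)
      also have "\<dots> = t * (k * ?l t)" by simp
      also have "\<dots> \<le> t * q" using True by auto
      finally show ?thesis using w_sum[OF t] by simp
    next
      case False
      then have t1: "1 \<le> t" and q: "q + 1 \<le> k * ?l t" by auto
      have eq: "{1..j - 1} = {1..t} \<union> {t + 1..j - 1}" using t by auto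
      have "deg_on {1..j - 1} l = deg_on {1..t} l + sum ?l {t + 1..j - 1}"
        unfolding deg_on_def eq by (rule sum.union_disjoint) auto
      moreover have "(j - 1 - t) * ?l t \<le> sum ?l {t + 1..j - 1}"
      proof -
        have "?l t \<le> ?l i" if "i \<in> {t + 1..j - 1}" for i
          using that t1 j by (intro Pn_mono[OF l]) auto
        from sum_bounded_below[of "{t + 1..j - 1}" "?l t" ?l, OF this] show ?thesis by simp
      qed
      ultimately have "deg_on {1..t} l + (j - 1 - t) * ?l t \<le> deg_on {1..j - 1} l" by simp
      then have "k * (deg_on {1..t} l + (j - 1 - t) * ?l t) \<le> (j - 1) * q + r"
        unfolding qr(1)[symmetric] by (rule mult_le_mono2)
      moreover have "(j - 1 - t) * (q + 1) \<le> k * ((j - 1 - t) * ?l t)"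
        using mult_le_mono2[OF q, of "j - 1 - t"] by (simp add: mult.left_commute)
      moreover have "(j - 1) * q = (j - 1 - t) * q + t * q"
        using t by (simp flip: add_mult_distrib)
      ultimately have "k * deg_on {1..t} l + (j - 1 - t) \<le> t * q + r"
        by (simp add: distrib_left)
      then show ?thesis using w_sum[OF t] t by simp
    qed
  next
    obtain i where i: "j = Suc i" using j by (cases j) auto
    have "sum w {1..j} = sum w {1..j - 1} + w j" by (simp add: i)
    also have "\<dots> = k * deg_on {1..j - 1} l + (k * ?l j - 1)"
      using w_sum[of "j - 1"] j qr by (simp add: w_def)
    also have "\<dots> < k * deg_on {1..j - 1} l + k * ?l j" using big by simp
    also have "\<dots> = k * deg_on {1..j} l"
      using deg_on_prefix[of j l] j by (simp add: distrib_left)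
    finally show "sum w {1..j} < k * deg_on {1..j} l" .
  qed (use j in auto)
qed

text \<open>By integrality \<open>deg_on {1..j - 1} l + 1 \<le> (j - 1) * l_j\<close>. Multiplied by
  \<open>k > j * (j - 1)\<close>, the spare unit becomes more than \<open>j\<close> after division
  by \<open>j - 1\<close>, so \<open>k * l_j\<close> exceeds \<open>q + j\<close>, which is at least
  \<open>q + 2\<close>.\<close>

lemma nonredundant_at_large:
  assumes l: "l \<in> Pn n" and j: "2 \<le> j" "j \<le> n"
    and less: "Poly_Mapping.lookup l 1 < Poly_Mapping.lookup l j" and k: "j * (j - 1) < k"
  shows "nonredundant_at n (\<lambda>t. k * deg_on {1..t} l) j"
proof -
  let ?l = "Poly_Mapping.lookup l"
  define q where "q = k * deg_on {1..j - 1} l div (j - 1)"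
  define r where "r = k * deg_on {1..j - 1} l mod (j - 1)"
  have qr: "k * deg_on {1..j - 1} l = (j - 1) * q + r"
    by (simp add: q_def r_def)
  have "r < j - 1" using j by (simp add: r_def)
  have "deg_on {1..j - 1} l < (\<Sum>i=1..j - 1. ?l j)"
    unfolding deg_on_def using j less Pn_mono[OF l] by (intro sum_strict_mono_ex1) auto
  then have "deg_on {1..j - 1} l + 1 \<le> (j - 1) * ?l j" by simp
  then have "k * (deg_on {1..j - 1} l + 1) \<le> k * ((j - 1) * ?l j)" by (rule mult_le_mono2)
  then have "(j - 1) * q + r + k \<le> (j - 1) * (k * ?l j)"
    unfolding qr[symmetric] by (simp add: algebra_simps)
  moreover have "(j - 1) * (q + j) = (j - 1) * q + j * (j - 1)"
    by (simp only: distrib_left mult.commute[of j])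
  ultimately have "(j - 1) * (q + j) < (j - 1) * (k * ?l j)"
    using k by linarith
  then have "q + j < k * ?l j" by simp
  then show ?thesis
    using j \<open>r < j - 1\<close> by (intro nonredundant_at_balanced[OF l j qr]) auto
qed

section \<open>Comparing index sets and moving witnesses by permutations\<close>

lemma deg_ge_1_subset_iff:
  assumes "F \<subseteq> {1..n}" "G \<subseteq> {1..n}"
  shows "deg_ge n F 1 \<subseteq> deg_ge n G 1 \<longleftrightarrow> F \<subseteq> G"
proof
  have fin: "finite F" "finite G" using assms finite_subset by blast+
  assume sub: "deg_ge n F 1 \<subseteq> deg_ge n G 1"
  show "F \<subseteq> G"
  proof
    fix i assume i: "i \<in> F"
    then have "Poly_Mapping.single i 1 \<in> expvecs n"
      using assms by (intro single_in_expvecs) auto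
    then have "Poly_Mapping.single i 1 \<in> deg_ge n F 1"
      using i by (simp add: deg_ge_def fin)
    then have "Poly_Mapping.single i 1 \<in> deg_ge n G 1" using sub by blast
    then show "i \<in> G" by (simp add: deg_ge_def fin split: if_splits)
  qed
next
  assume "F \<subseteq> G"
  then have "deg_on F u \<le> deg_on G u" for u
    unfolding deg_on_def using assms finite_subset by (intro sum_mono2) blast+
  then show "deg_ge n F 1 \<subseteq> deg_ge n G 1"
    by (auto simp: deg_ge_def intro: order_trans)
qed

lemma exists_constant_exponent:
  assumes "W \<subseteq> {1..n}"
  obtains v where "v \<in> expvecs n" "\<And>i. Poly_Mapping.lookup v i = (if i \<in> W then N else 0)"
proof -
  have "finite {i. (if i \<in> W then N else 0) \<noteq> 0}"
    by (rule finite_subset[of _ "{1..n}"]) (use assms in \<open>auto split: if_splits\<close>)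
  from lookup_Abs_poly_mapping[OF this] show thesis
    using assms by (intro that[of "Poly_Mapping.Abs_poly_mapping (\<lambda>i. if i \<in> W then N else 0)"])
      (auto simp: expvecs_iff)
qed

lemma le_deg_on_constant:
  assumes "finite G" "i \<in> G" "N \<le> Poly_Mapping.lookup v i"
  shows "N \<le> deg_on G v"
  unfolding deg_on_def using assms member_le_sum[of i G "Poly_Mapping.lookup v"] by simp

text \<open>Sort the indicator vector of the complement of \<open>F\<close>: its zeros, located
  exactly on \<open>F\<close> within \<open>{1..n}\<close>, come first.\<close>

lemma exists_permutation_image:
  assumes F: "F \<subseteq> {1..n}"
  obtains \<sigma> where "\<sigma> permutes {1..n}" "\<sigma> ` {1..card F} = F"
proof -
  have fin: "finite F" using F finite_subset by blast
  have "{1..n} - F \<subseteq> {1..n}" by blast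
  then obtain v where v: "v \<in> expvecs n"
    "\<And>i. Poly_Mapping.lookup v i = (if i \<in> {1..n} - F then 1 else 0)"
    by (rule exists_constant_exponent[where N = 1]) blast
  obtain \<sigma> where \<sigma>: "\<sigma> permutes {1..n}" "Poly_Mapping.map_key \<sigma> v \<in> Pn n"
    using exists_sorting_permutation[OF v(1)] .
  let ?G = "inv_into UNIV \<sigma> ` F"
  have card: "card ?G = card F" by (rule card_image[OF permutes_inj_on[OF permutes_inv[OF \<sigma>(1)]]])
  have "?G \<subseteq> {1..n}" using F permutes_in_image[OF permutes_inv[OF \<sigma>(1)]] by blast
  from Pn_prefix_le[OF \<sigma>(2) this]
  have "deg_on (\<sigma> ` {1..card F}) v \<le> deg_on (\<sigma> ` ?G) v"
    by (simp add: card deg_on_map_key[OF permutes_inj[OF \<sigma>(1)]])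
  also have "\<sigma> ` ?G = F"
    by (simp add: image_image permutes_inverses(1)[OF \<sigma>(1)])
  also have "deg_on F v = 0" by (simp add: deg_on_def v(2))
  finally have zero: "Poly_Mapping.lookup v i = 0" if "i \<in> \<sigma> ` {1..card F}" for i
    using that by (auto simp: deg_on_def)
  have "card F \<le> n" using card_mono[OF _ F] by simp
  then have sub: "\<sigma> ` {1..card F} \<subseteq> {1..n}"
    using permutes_in_image[OF \<sigma>(1)] by fastforce
  have "\<sigma> ` {1..card F} \<subseteq> F"
  proof
    fix i assume i: "i \<in> \<sigma> ` {1..card F}"
    with sub have "i \<in> {1..n}" by blast
    then show "i \<in> F" using zero[OF i] v(2)[of i] by (auto split: if_splits)
  qed
  moreover have "card (\<sigma> ` {1..card F}) = card F"
    by (simp add: card_image[OF permutes_inj_on[OF \<sigma>(1)]])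
  ultimately have "\<sigma> ` {1..card F} = F" by (rule card_subset_eq[OF fin])
  with \<sigma>(1) show thesis by (rule that)
qed

lemma nonredundant_at_perm:
  assumes "nonredundant_at n b j" and \<sigma>: "\<sigma> permutes {1..n}"
  obtains u where "u \<in> expvecs n" "deg_on (\<sigma> ` {1..j}) u < b j"
    "\<And>G. G \<subseteq> {1..n} \<Longrightarrow> G \<noteq> \<sigma> ` {1..j} \<Longrightarrow> b (card G) \<le> deg_on G u"
proof -
  obtain u where u: "u \<in> expvecs n" "deg_on {1..j} u < b j"
    "\<And>G. G \<subseteq> {1..n} \<Longrightarrow> G \<noteq> {1..j} \<Longrightarrow> b (card G) \<le> deg_on G u"
    using assms(1) unfolding nonredundant_at_def by blast
  note inv = permutes_inv[OF \<sigma>]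
  let ?u = "Poly_Mapping.map_key (inv_into UNIV \<sigma>) u"
  note deg = deg_on_map_key[OF permutes_inj[OF inv], of _ u]
  have "b (card G) \<le> deg_on G ?u" if G: "G \<subseteq> {1..n}" "G \<noteq> \<sigma> ` {1..j}" for G
  proof -
    have "\<sigma> ` inv_into UNIV \<sigma> ` G = G"
      by (simp add: image_image permutes_inverses(1)[OF \<sigma>])
    then have "inv_into UNIV \<sigma> ` G \<noteq> {1..j}" using G(2) by metis
    moreover have "inv_into UNIV \<sigma> ` G \<subseteq> {1..n}"
      using G(1) permutes_in_image[OF inv] by blast
    ultimately show ?thesis
      using u(3)[of "inv_into UNIV \<sigma> ` G"] by (simp add: deg card_image[OF permutes_inj_on[OF inv]])
  qed
  moreover have "deg_on (\<sigma> ` {1..j}) ?u < b j"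
    using u(2) by (simp add: deg image_image permutes_inverses(2)[OF \<sigma>])
  moreover have "?u \<in> expvecs n" using u(1) by (simp add: map_key_in_expvecs_iff[OF inv])
  ultimately show thesis using that by blast
qed


section \<open>Minimal primes and the symbolic power\<close>

lemma var_in_prime_of_xpow:
  fixes Q :: "'k::field mpoly set"
  assumes Q: "primeideal Q (poly_ring n)"
  shows "u \<in> expvecs n \<Longrightarrow> xpow u \<in> Q \<Longrightarrow> \<exists>i \<in> Poly_Mapping.keys u. var i \<in> Q"
proof (induction "deg_on {1..n} u" arbitrary: u rule: less_induct)
  case (less u)
  interpret Q: primeideal Q "poly_ring n" by fact
  show ?case
  proof (cases "u = 0")
    case True
    then have "\<one>\<^bsub>poly_ring n\<^esub> \<in> Q" using less.prems by (simp add: xpow_def poly_ring_eq)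
    then show ?thesis using Q.one_imp_carrier Q.I_notcarr by blast
  next
    case False
    then obtain i where i: "i \<in> Poly_Mapping.keys u" by (metis all_not_in_conv keys_eq_empty)
    then have i_n: "i \<in> {1..n}" using less.prems(1) by (auto simp: expvecs_def)
    let ?v = "u - Poly_Mapping.single i 1"
    have eq: "?v + Poly_Mapping.single i 1 = u"
      using i by (intro diff_single_add) (simp add: in_keys_iff)
    have v: "?v \<in> expvecs n" using less.prems(1) by (rule diff_in_expvecs)
    have "xpow ?v * var i \<in> Q"
      using less.prems(2) by (subst (asm) eq[symmetric]) (simp add: xpow_add var_def)
    moreover have "xpow ?v \<in> carrier (poly_ring n)" "(var i :: 'k mpoly) \<in> carrier (poly_ring n)"
      using v single_in_expvecs[OF i_n] by (simp_all add: carrier_poly_ring var_def)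
    ultimately consider "var i \<in> Q" | "xpow ?v \<in> Q"
      using Q.I_prime[of "xpow ?v" "var i"] by (auto simp: poly_ring_eq)
    then show ?thesis
    proof cases
      case 2
      have "deg_on {1..n} ?v < deg_on {1..n} u"
        using i_n by (subst (2) eq[symmetric]) (simp add: deg_on_add)
      from less.hyps[OF this v 2] show ?thesis
        by (auto simp: in_keys_iff lookup_minus)
    qed (use i in blast)
  qed
qed

text \<open>A prime \<open>Q\<close> above the ideal contains at least \<open>j\<close> variables:
  if the set \<open>V\<close> of its variables were smaller, the monomial with exponent
  \<open>b n\<close> off \<open>V\<close> would lie in the ideal, although none of its variables is
  in \<open>Q\<close>. Primes of \<open>j\<close> variables are pairwise incomparable by
  cardinality.\<close>

lemma minimal_primes_card_bounded:
  fixes b :: "nat \<Rightarrow> nat"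
  assumes mono: "\<And>s t. s \<le> t \<Longrightarrow> t \<le> n \<Longrightarrow> b s \<le> b t"
    and zero: "\<And>t. t < j \<Longrightarrow> b t = 0" and pos: "1 \<le> b j"
  shows "minimal_primes (poly_ring n) (mono_span (card_bounded n b))
    = (\<lambda>F. mono_span (deg_ge n F 1) :: 'k::field mpoly set) ` {F. F \<subseteq> {1..n} \<and> card F = j}"
    (is "minimal_primes _ ?I = ?p ` ?F")
proof -
  have contains: "?I \<subseteq> ?p F" if "F \<in> ?F" for F
  proof -
    have "u \<in> deg_ge n F 1" if "u \<in> card_bounded n b" for u
    proof -
      have "u \<in> expvecs n" "b j \<le> deg_on F u"
        using that \<open>F \<in> ?F\<close> by (auto simp: card_bounded_def)
      then show ?thesis using pos by (simp add: deg_ge_def)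
    qed
    then show ?thesis by auto
  qed
  have above: "\<exists>F \<in> ?F. ?p F \<subseteq> Q" if Q: "primeideal Q (poly_ring n)" "?I \<subseteq> Q" for Q
  proof -
    interpret Q: primeideal Q "poly_ring n" by fact
    define V where "V = {i \<in> {1..n}. var i \<in> Q}"
    have "{1..n} - V \<subseteq> {1..n}" by blast
    then obtain u where u: "u \<in> expvecs n"
      "\<And>i. Poly_Mapping.lookup u i = (if i \<in> {1..n} - V then b n else 0)"
      by (rule exists_constant_exponent[where N = "b n"]) blast
    have "j \<le> card V"
    proof (rule ccontr)
      assume less: "\<not> j \<le> card V"
      have "b (card G) \<le> deg_on G u" if G: "G \<subseteq> {1..n}" for G
      proof (cases "G \<subseteq> V")
        case True
        then have "card G < j"
          using less card_mono[of V G] by (simp add: V_def)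
        then show ?thesis by (simp add: zero)
      next
        case False
        then obtain i where "i \<in> G" "i \<in> {1..n} - V" using G by blast
        moreover have "finite G" using G finite_subset by blast
        ultimately have "b n \<le> deg_on G u" by (intro le_deg_on_constant[of G i]) (simp_all add: u(2))
        moreover have "b (card G) \<le> b n" using card_mono[OF _ G] by (intro mono) simp_all
        ultimately show ?thesis by simp
      qed
      then have "xpow u \<in> ?I" using u(1) by (simp add: card_bounded_def)
      then obtain i where "i \<in> Poly_Mapping.keys u" "var i \<in> Q"
        using var_in_prime_of_xpow[OF Q(1) u(1)] Q(2) by blast
      then show False by (auto simp: in_keys_iff u(2) V_def split: if_splits)
    qed
    then obtain F where F: "F \<subseteq> V" "card F = j"
      using obtain_subset_with_card_n by blast
    then have "F \<in> ?F" by (auto simp: V_def)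
    moreover have "var ` F \<subseteq> Q" using F(1) by (auto simp: V_def)
    then have "Idl\<^bsub>poly_ring n\<^esub> (var ` F) \<subseteq> Q"
      by (rule Q.genideal_minimal[OF Q.ideal_axioms])
    ultimately show ?thesis using genideal_var[of F n] by auto
  qed
  show ?thesis
  proof (intro equalityI subsetI)
    fix P :: "'k mpoly set" assume "P \<in> minimal_primes (poly_ring n) ?I"
    then have P: "primeideal P (poly_ring n)" "?I \<subseteq> P"
      "\<And>Q. primeideal Q (poly_ring n) \<Longrightarrow> ?I \<subseteq> Q \<Longrightarrow> Q \<subseteq> P \<Longrightarrow> Q = P"
      by (auto simp: minimal_primes_def)
    obtain F where F: "F \<in> ?F" "?p F \<subseteq> P" using above[OF P(1,2)] by blast
    then have "?p F = P" using P(3)[OF primeideal_deg_ge contains[OF F(1)]] by blast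
    then show "P \<in> ?p ` ?F" using F(1) by blast
  next
    fix P :: "'k mpoly set" assume "P \<in> ?p ` ?F"
    then obtain F where F: "F \<in> ?F" "P = ?p F" by blast
    have "Q = P" if Q: "primeideal Q (poly_ring n)" "?I \<subseteq> Q" "Q \<subseteq> P" for Q
    proof -
      obtain G where G: "G \<in> ?F" "?p G \<subseteq> Q" using above[OF Q(1,2)] by blast
      then have "?p G \<subseteq> ?p F" using Q(3) F(2) by blast
      then have "G \<subseteq> F" using F(1) G(1) deg_ge_1_subset_iff[of G n F] by simp
      then have "G = F" using F(1) G(1) by (intro card_subset_eq) (auto intro: finite_subset)
      then show ?thesis using G(2) Q(3) F(2) by blast
    qed
    then show "P \<in> minimal_primes (poly_ring n) ?I"
      unfolding minimal_primes_def using primeideal_deg_ge contains[OF F(1)] F(2) by blast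
  qed
qed

text \<open>The witness \<open>v\<close> is \<open>b n\<close> off \<open>F\<close> and 0 on
  \<open>F\<close>. It settles the bound of every set not inside \<open>F\<close>; proper subsets of
  \<open>F\<close> have bound 0, so only the bound of \<open>F\<close> survives.\<close>

lemma loc_contraction_card_bounded:
  fixes b :: "nat \<Rightarrow> nat"
  assumes mono: "\<And>s t. s \<le> t \<Longrightarrow> t \<le> n \<Longrightarrow> b s \<le> b t"
    and zero: "\<And>t. t < card F \<Longrightarrow> b t = 0" and F: "F \<subseteq> {1..n}"
  shows "loc_contraction n (mono_span (deg_ge n F 1)) (mono_span (card_bounded n b))
    = (mono_span (deg_ge n F (b (card F))) :: 'k::field mpoly set)"
proof (rule loc_contraction_deg_ge)
  show "ideal (mono_span (card_bounded n b) :: 'k mpoly set) (poly_ring n)"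
    by (intro ideal_mono_span upset_card_bounded)
  show "(mono_span (card_bounded n b) :: 'k mpoly set) \<subseteq> mono_span (deg_ge n F (b (card F)))"
    using F by (auto simp: card_bounded_def deg_ge_def)
  fix u assume u: "u \<in> deg_ge n F (b (card F))"
  have fin: "finite F" using F finite_subset by blast
  have "{1..n} - F \<subseteq> {1..n}" by blast
  then obtain v where v: "v \<in> expvecs n"
    "\<And>i. Poly_Mapping.lookup v i = (if i \<in> {1..n} - F then b n else 0)"
    by (rule exists_constant_exponent[where N = "b n"]) blast
  have "b (card G) \<le> deg_on G (u + v)" if G: "G \<subseteq> {1..n}" for G
  proof -
    consider "G = F" | "G \<subset> F" | "\<not> G \<subseteq> F" by blast
    then show ?thesis
    proof cases
      case 1
      then show ?thesis using u by (simp add: deg_ge_def deg_on_add)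
    next
      case 2
      then show ?thesis using zero psubset_card_mono[OF fin 2] by simp
    next
      case 3
      then obtain i where "i \<in> G" "i \<in> {1..n} - F" using G by blast
      moreover have "finite G" using G finite_subset by blast
      ultimately have "b n \<le> deg_on G v" by (intro le_deg_on_constant[of G i]) (simp_all add: v(2))
      moreover have "b (card G) \<le> b n" using card_mono[OF _ G] by (intro mono) simp_all
      ultimately show ?thesis by (simp add: deg_on_add)
    qed
  qed
  then have "u + v \<in> card_bounded n b"
    using u v(1) by (auto simp: card_bounded_def deg_ge_def add_in_expvecs)
  moreover have "deg_on F v = 0" by (simp add: deg_on_def v(2))
  ultimately show "\<exists>v \<in> expvecs n. deg_on F v = 0 \<and> xpow (u + v) \<in> (mono_span (card_bounded n b) :: 'k mpoly set)"
    using v(1) by auto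
qed


section \<open>Primary decompositions of the powers\<close>

lemma redundant_mono_span:
  "redundant (poly_ring n) A (\<lambda>i. mono_span (S i) :: 'k::field mpoly set) j
     \<longleftrightarrow> expvecs n \<inter> (\<Inter>i \<in> A - {j}. S i) \<subseteq> S j"
proof -
  have "(\<lambda>i. mono_span (S i) :: 'k mpoly set) ` (A - {j}) = mono_span ` S ` (A - {j})"
    by (simp add: image_image)
  then show ?thesis
    unfolding redundant_def by (simp only: ideal_Inter_mono_span mono_span_subset_iff)
qed

lemma not_redundant_sym_power:
  assumes "nonredundant_at n b j" "j \<le> n"
  shows "\<not> redundant (poly_ring n) {1..n} (\<lambda>i. sym_power n i (b i) :: 'k::field mpoly set) j"
proof -
  obtain u where u: "u \<in> expvecs n" "deg_on {1..j} u < b j"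
    "\<And>G. G \<subseteq> {1..n} \<Longrightarrow> G \<noteq> {1..j} \<Longrightarrow> b (card G) \<le> deg_on G u"
    using assms(1) unfolding nonredundant_at_def by blast
  have "b i \<le> deg_on G u" if "i \<noteq> j" "G \<subseteq> {1..n}" "card G = i" for i G
    using u(3)[of G] that by (cases "G = {1..j}") auto
  moreover have "{1..j} \<subseteq> {1..n}" "card {1..j} = j" "\<not> b j \<le> deg_on {1..j} u"
    using assms(2) u(2) by auto
  ultimately show ?thesis
    unfolding sym_power_eq redundant_mono_span using u(1) by blast
qed

lemma redundant_sym_power_0: "redundant (poly_ring n) A (\<lambda>i. sym_power n i (m i) :: 'k::field mpoly set) j"
  if "m j = 0"
  unfolding sym_power_eq redundant_mono_span using that by auto

text \<open>The intersection starts at \<open>j = 1\<close>; \<open>b 0 = 0\<close> makes the bound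
  of the empty set vacuous.\<close>

lemma card_bounded_eq_Inter:
  assumes "b 0 = 0"
  shows "(mono_span (card_bounded n b) :: 'k::field mpoly set)
    = ideal_Inter (poly_ring n) ((\<lambda>j. sym_power n j (b j)) ` {1..n})"
proof -
  let ?S = "\<lambda>j. {u \<in> expvecs n. \<forall>F \<subseteq> {1..n}. card F = j \<longrightarrow> b j \<le> deg_on F u}"
  have "card_bounded n b = expvecs n \<inter> \<Inter> (?S ` {1..n})"
  proof (intro equalityI subsetI)
    fix u assume u: "u \<in> expvecs n \<inter> \<Inter> (?S ` {1..n})"
    have "b (card F) \<le> deg_on F u" if F: "F \<subseteq> {1..n}" for F
    proof (cases "card F = 0")
      case False
      then have "card F \<in> {1..n}" using card_mono[OF _ F] by simp
      then show ?thesis using u F by blast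
    qed (simp add: assms)
    then show "u \<in> card_bounded n b" using u by (simp add: card_bounded_def)
  qed (auto simp: card_bounded_def)
  moreover have "(\<lambda>j. sym_power n j (b j)) ` {1..n} = (mono_span ` ?S ` {1..n} :: 'k mpoly set set)"
    by (simp only: sym_power_eq image_image)
  ultimately show ?thesis
    by (simp only: ideal_Inter_mono_span)
qed

lemma constant_prefix:
  assumes l: "l \<in> Pn n" and i: "1 \<le> i" "i \<le> n" "Poly_Mapping.lookup l 1 = Poly_Mapping.lookup l i"
  shows "deg_on {1..i} l = i * Poly_Mapping.lookup l 1"
proof -
  have "Poly_Mapping.lookup l x = Poly_Mapping.lookup l 1" if "x \<in> {1..i}" for x
    using Pn_mono[OF l, of 1 x] Pn_mono[OF l, of x i] that i by simp
  then have "deg_on {1..i} l = (\<Sum>x=1..i. Poly_Mapping.lookup l 1)"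
    unfolding deg_on_def by (rule sum.cong[OF refl])
  then show ?thesis by simp
qed

text \<open>On a constant initial segment the bound for \<open>F\<close> is \<open>card F\<close>
  times the bound for a singleton, so it follows by adding up the bounds of the elements of
  \<open>F\<close>.\<close>

lemma constant_prefix_le_deg_on:
  assumes l: "l \<in> Pn n" and F: "F \<subseteq> {1..n}" "F \<noteq> {}"
    and const: "Poly_Mapping.lookup l 1 = Poly_Mapping.lookup l (card F)"
    and u: "\<And>x. x \<in> F \<Longrightarrow> k * deg_on {1..1} l \<le> deg_on {x} u"
  shows "k * deg_on {1..card F} l \<le> deg_on F u"
proof -
  have fin: "finite F" using F finite_subset by blast
  have "1 \<le> card F" "card F \<le> n"
    using F fin card_mono[OF _ F(1)] by (simp_all add: Suc_le_eq card_gt_0_iff)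
  then have "k * deg_on {1..card F} l = of_nat (card F) * (k * Poly_Mapping.lookup l 1)"
    using constant_prefix[OF l _ _ const] by simp
  also have "\<dots> \<le> deg_on F u"
    unfolding deg_on_def using u by (intro sum_bounded_below) (simp add: deg_on_def)
  finally show ?thesis .
qed

lemma redundant_sym_power_constant:
  assumes l: "l \<in> Pn n" and j: "1 < j" "j \<le> n" "Poly_Mapping.lookup l 1 = Poly_Mapping.lookup l j"
  shows "redundant (poly_ring n) {1..n} (\<lambda>i. sym_power n i (k * deg_on {1..i} l) :: 'k::field mpoly set) j"
  unfolding sym_power_eq redundant_mono_span
proof
  fix u assume "u \<in> expvecs n \<inter> (\<Inter>i \<in> {1..n} - {j}.
    {u \<in> expvecs n. \<forall>F \<subseteq> {1..n}. card F = i \<longrightarrow> k * deg_on {1..i} l \<le> deg_on F u})"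
  \<comment> \<open>The singleton bounds are still available after the component of \<open>j\<close>
    is dropped, since \<open>j > 1\<close>.\<close>
  moreover have "1 \<in> {1..n} - {j}" using j by simp
  ultimately have u: "u \<in> expvecs n"
    and u1: "\<And>F. F \<subseteq> {1..n} \<Longrightarrow> card F = 1 \<Longrightarrow> k * deg_on {1..1} l \<le> deg_on F u" by blast+
  have "k * deg_on {1..j} l \<le> deg_on F u" if F: "F \<subseteq> {1..n}" "card F = j" for F
  proof -
    have "F \<noteq> {}" using F j by auto
    moreover have "k * deg_on {1..1} l \<le> deg_on {x} u" if "x \<in> F" for x
      using that F(1) by (intro u1) auto
    ultimately show ?thesis
      using constant_prefix_le_deg_on[OF l F(1), of k u] F(2) j(3) by simp
  qed
  then show "u \<in> {u \<in> expvecs n. \<forall>F \<subseteq> {1..n}. card F = j \<longrightarrow> k * deg_on {1..j} l \<le> deg_on F u}"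
    using u by blast
qed

text \<open>Distinct index sets give distinct radicals, and each component is irredundant by the
  witness for \<open>{1..card F}\<close> carried over to \<open>F\<close> by a permutation.
  \<open>cover\<close> expresses that the bounds with sizes in \<open>J\<close> imply all the
  others.\<close>

lemma minimal_primary_decomposition_deg_ge:
  assumes J: "J \<subseteq> {1..n}" "\<And>j. j \<in> J \<Longrightarrow> nonredundant_at n b j"
    and cover: "\<And>u. u \<in> expvecs n \<Longrightarrow>
        (\<And>F. F \<subseteq> {1..n} \<Longrightarrow> card F \<in> J \<Longrightarrow> b (card F) \<le> deg_on F u) \<Longrightarrow> u \<in> card_bounded n b"
  shows "minimal_primary_decomposition (poly_ring n) (mono_span (card_bounded n b))
    ((\<lambda>F. mono_span (deg_ge n F (b (card F))) :: 'k::field mpoly set) ` {F. F \<subseteq> {1..n} \<and> card F \<in> J})"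
    (is "minimal_primary_decomposition _ _ (?q ` ?F)")
  unfolding minimal_primary_decomposition_def
proof (intro conjI ballI)
  have "?F \<subseteq> Pow {1..n}" by blast
  then have "finite ?F" by (rule finite_subset) simp
  then show "finite (?q ` ?F)" by (rule finite_imageI)
  \<comment> \<open>The witness has a degree below the bound, so the bound is positive; a zeroth
    power would be the whole ring and not primary.\<close>
  have pos: "1 \<le> b (card F)" if "F \<in> ?F" for F
    using J(2)[of "card F"] that by (auto simp: nonredundant_at_def)
  show "primary_ideal (poly_ring n) Q" if "Q \<in> ?q ` ?F" for Q
    using that by (elim imageE) (simp only: primary_ideal_deg_ge[OF pos])
  have "card_bounded n b = expvecs n \<inter> \<Inter> ((\<lambda>F. deg_ge n F (b (card F))) ` ?F)"
  proof (intro equalityI subsetI)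
    fix u assume "u \<in> expvecs n \<inter> \<Inter> ((\<lambda>F. deg_ge n F (b (card F))) ` ?F)"
    then show "u \<in> card_bounded n b" by (intro cover) (auto simp: deg_ge_def)
  qed (auto simp: card_bounded_def deg_ge_def)
  moreover have "?q ` ?F = mono_span ` (\<lambda>F. deg_ge n F (b (card F))) ` ?F"
    by (simp only: image_image)
  ultimately show "mono_span (card_bounded n b) = ideal_Inter (poly_ring n) (?q ` ?F)"
    by (simp only: ideal_Inter_mono_span)
  show "inj_on (ideal_radical (poly_ring n)) (?q ` ?F)"
  proof (rule inj_onI)
    fix Q Q' assume "Q \<in> ?q ` ?F" "Q' \<in> ?q ` ?F"
    then obtain F G where FG: "F \<in> ?F" "G \<in> ?F" "Q = ?q F" "Q' = ?q G" by blast
    assume "ideal_radical (poly_ring n) Q = ideal_radical (poly_ring n) Q'"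
    then have "deg_ge n F 1 = deg_ge n G 1"
      unfolding FG(3,4) ideal_radical_deg_ge[OF pos[OF FG(1)]] ideal_radical_deg_ge[OF pos[OF FG(2)]]
      by (simp only: mono_span_inject)
    then have "F = G"
      using deg_ge_1_subset_iff[of F n G] deg_ge_1_subset_iff[of G n F] FG(1,2) by blast
    then show "Q = Q'" using FG by simp
  qed
  fix Q assume "Q \<in> ?q ` ?F"
  then obtain F where F: "F \<subseteq> {1..n}" "card F \<in> J" "Q = ?q F" by blast
  obtain \<sigma> where \<sigma>: "\<sigma> permutes {1..n}" "\<sigma> ` {1..card F} = F"
    using exists_permutation_image[OF F(1)] .
  obtain u where u: "u \<in> expvecs n" "deg_on F u < b (card F)"
    "\<And>G. G \<subseteq> {1..n} \<Longrightarrow> G \<noteq> F \<Longrightarrow> b (card G) \<le> deg_on G u"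
    using nonredundant_at_perm[OF J(2)[OF F(2)] \<sigma>(1)] \<sigma>(2) by metis
  have "xpow u \<in> Q'" if Q': "Q' \<in> ?q ` ?F - {Q}" for Q'
  proof -
    from Q' have "Q' \<in> ?q ` ?F" by (rule DiffD1)
    then obtain G where G: "Q' = ?q G" "G \<in> ?F" by (rule imageE)
    have "G \<noteq> F"
    proof
      assume "G = F"
      then have "Q' = Q" using G(1) F(3) by simp
      then show False using Q' by simp
    qed
    then have "b (card G) \<le> deg_on G u" using u(3) G(2) by blast
    with u(1) show ?thesis
      unfolding G(1) xpow_in_mono_span deg_ge_def by blast
  qed
  moreover have "xpow u \<in> carrier (poly_ring n)"
    unfolding carrier_poly_ring xpow_in_mono_span by (rule u(1))
  ultimately have "xpow u \<in> ideal_Inter (poly_ring n) (id ` (?q ` ?F - {Q}))"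
    unfolding ideal_Inter_def image_id id_apply by blast
  moreover have "xpow u \<notin> Q"
    unfolding F(3) xpow_in_mono_span deg_ge_def using u(2) by simp
  ultimately show "\<not> redundant (poly_ring n) (?q ` ?F) id Q"
    unfolding redundant_def id_apply by blast
qed

lemma perm_prime_power:
  assumes \<sigma>: "\<sigma> permutes {1..n}" and j: "j \<le> n"
  shows "ideal_pow (poly_ring n) (perm_poly \<sigma> ` (Idl\<^bsub>poly_ring n\<^esub> (var ` {1..j}))) m
    = (mono_span (deg_ge n (\<sigma> ` {1..j}) m) :: 'k::field mpoly set)"
proof -
  have "{1..j} \<subseteq> {1..n}" using j by simp
  moreover from this have "\<sigma> ` {1..j} \<subseteq> {1..n}"
    using permutes_in_image[OF \<sigma>] by blast
  ultimately show ?thesis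
    by (simp only: genideal_var perm_poly_mono_span[OF permutes_bij[OF \<sigma>]]
        vimage_map_key_deg_ge[OF \<sigma>] ideal_pow_mono_span nfold_sums_deg_ge)
qed

text \<open>Passes from integer quotients and a real inequality to naturals:
  \<open>r \<le> j - 2\<close> gives \<open>q + j - r \<ge> q + 2\<close>.\<close>

lemma nonredundant_at_quotient:
  fixes q r :: int
  assumes l: "l \<in> Pn n" and j: "2 \<le> j" "j \<le> n"
    and qr: "int (k * deg_on {1..j - 1} l) = (int j - 1) * q + r" "0 \<le> r" "r \<le> int j - 2"
    and k: "1 \<le> k" and big: "real (Poly_Mapping.lookup l j) > (real_of_int q + real j - real_of_int r) / real k"
  shows "nonredundant_at n (\<lambda>t. k * deg_on {1..t} l) j"
proof (rule nonredundant_at_balanced[OF l j])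
  \<comment> \<open>A negative \<open>q\<close> would give at most
    \<open>-(j - 1) + (j - 2) < 0\<close> for a natural number.\<close>
  have "0 \<le> q"
  proof (rule ccontr)
    assume "\<not> 0 \<le> q"
    then have "(int j - 1) * q \<le> (int j - 1) * (- 1)" using j by (intro mult_left_mono) auto
    then have "int (k * deg_on {1..j - 1} l) < 0" using qr by simp
    then show False by (simp only: of_nat_less_0_iff)
  qed
  then have "int (k * deg_on {1..j - 1} l) = int ((j - 1) * nat q + nat r)"
    using qr j by (simp add: of_nat_diff)
  then show "k * deg_on {1..j - 1} l = (j - 1) * nat q + nat r"
    by (simp only: of_nat_eq_iff)
  show "nat r \<le> j - 2" using qr(2,3) j by linarith
  have "real_of_int q + real j - real_of_int r < real (k * Poly_Mapping.lookup l j)"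
    using big k by (simp add: divide_less_eq mult.commute)
  then have "q + int j - r < int (k * Poly_Mapping.lookup l j)" by linarith
  then show "nat q + 2 \<le> k * Poly_Mapping.lookup l j" using qr(3) \<open>0 \<le> q\<close> by linarith
qed

theorem theorem5p7:
  fixes n :: nat
    and l :: "nat \<Rightarrow>\<^sub>0 nat"
    and R :: "('k::field) mpoly ring"
    and I :: "'k mpoly set"
    and P :: "nat \<Rightarrow> 'k mpoly set"
    and a :: "nat \<Rightarrow> nat"
    and j' :: nat
    and \<I> :: "nat set"
  assumes "R = poly_ring n"
    and "l \<in> Pn n" and "l \<noteq> 0"
    and "I = Sss n {l}"
    and "j' = Min {i \<in> {1..n}. Poly_Mapping.lookup l i > 0}"
    and "\<And>j. P j = Idl\<^bsub>R\<^esub> (var ` {1..j})"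
    and "\<And>j. a j = (\<Sum>i=1..j. Poly_Mapping.lookup l i)"
    and "\<I> = (if j' > 1 then {j \<in> {1..n}. j \<ge> j'}
               else {1} \<union> {j \<in> {1..n}. j > 1 \<and> Poly_Mapping.lookup l j \<noteq> Poly_Mapping.lookup l 1})"
  shows "(\<forall>k \<ge> 1.
      (let c = (\<lambda>j. sym_power n j (k * a j)) :: nat \<Rightarrow> 'k mpoly set;
           redundant_comp = redundant R {1..n} c
       in
         ideal_pow R I k = ideal_Inter R (c ` {1..n}) \<and>
         (\<forall>j \<in> {1..n}. j < j' \<longrightarrow> redundant_comp j) \<and>
         (\<not> redundant_comp j' \<and>
            sym_power_Min n I k = sym_power n j' (k * Poly_Mapping.lookup l j')) \<and>
         (\<forall>j \<in> {1..n}. j > j' \<and> Poly_Mapping.lookup l (j - 1) < Poly_Mapping.lookup l j \<longrightarrow>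
            \<not> redundant_comp j) \<and>
         (\<forall>j \<in> {1..n}. Poly_Mapping.lookup l 1 < Poly_Mapping.lookup l j \<and>
            (k > j * (j - 1) \<or>
             (\<exists>q r :: int. int (k * (\<Sum>i=1..j-1. Poly_Mapping.lookup l i)) = (int j - 1) * q + r \<and>
                0 \<le> r \<and> r \<le> int j - 2 \<and>
                real (Poly_Mapping.lookup l j) > (real_of_int q + real j - real_of_int r) / real k))
            \<longrightarrow> (\<not> redundant_comp j \<longleftrightarrow> j \<ge> j')) \<and>
         (\<forall>j \<in> {1..n}. j > 1 \<and> Poly_Mapping.lookup l 1 = Poly_Mapping.lookup l j \<longrightarrow>
            redundant_comp j))) \<and>
    (\<forall>\<^sub>F k in sequentially.
      minimal_primary_decomposition R (ideal_pow R I k)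
        {ideal_pow R (perm_poly \<sigma> ` P j) (k * a j) | j \<sigma>. j \<in> \<I> \<and> \<sigma> permutes {1..n}})"
proof -
  let ?l = "Poly_Mapping.lookup l"
  let ?b = "\<lambda>k t. k * deg_on {1..t} l"
  note l = assms(2)
  have a: "a = (\<lambda>t. deg_on {1..t} l)"
    unfolding deg_on_def by (rule ext) (rule assms(7))
  have P: "P = (\<lambda>j. Idl\<^bsub>poly_ring n\<^esub> (var ` {1..j}))"
    using assms(6) unfolding assms(1) by (rule ext)
  have pow: "ideal_pow R I k = mono_span (card_bounded n (?b k))" for k
    unfolding assms(1,4) Sss_eq[OF l] ideal_pow_mono_span nfold_sums_card_bounded[OF l] ..
  obtain i where "?l i \<noteq> 0"
    using assms(3) by (metis lookup_zero poly_mapping_eqI)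
  moreover then have "i \<in> {1..n}" using l by (auto simp: Pn_def expvecs_iff)
  ultimately have "{i \<in> {1..n}. ?l i > 0} \<noteq> {}" by blast
  \<comment> \<open>Nonemptiness, a consequence of \<open>l \<noteq> 0\<close>, is what makes
    \<open>Min\<close> an element of the set.\<close>
  then have "j' \<in> {i \<in> {1..n}. ?l i > 0}"
    unfolding assms(5) by (intro Min_in) simp_all
  then have j': "1 \<le> j'" "j' \<le> n" "?l j' > 0" by auto
  have l0: "?l i = 0" if "i < j'" "1 \<le> i" for i
  proof (rule ccontr)
    assume "?l i \<noteq> 0"
    then have "j' \<le> i" unfolding assms(5) using that j' by (intro Min_le) auto
    then show False using that by simp
  qed
  have deg0: "deg_on {1..t} l = 0" if "t < j'" for t
    using l0 that by (simp add: deg_on_def)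
  have deg_j': "deg_on {1..j'} l = ?l j'"
    using deg_on_prefix[OF j'(1), of l] deg0[of "j' - 1"] j'(1) by simp
  have b_mono: "?b k s \<le> ?b k t" if "s \<le> t" for k s t
    by (intro mult_le_mono2 deg_on_prefix_mono that)
  have first: "nonredundant_at n (?b k) j'" if "1 \<le> k" for k
    using j' that deg0 deg_j' by (intro nonredundant_at_first) auto
  have two: "2 \<le> j" if "j \<in> {1..n}" "?l 1 < ?l j" for j
  proof -
    have "j \<noteq> 1" using that(2) by auto
    then show ?thesis using that(1) by simp
  qed
  have c_red: "\<not> redundant (poly_ring n) {1..n} (\<lambda>j. sym_power n j (?b k j) :: 'k mpoly set) j"
    if "nonredundant_at n (?b k) j" "j \<le> n" for k j
    using not_redundant_sym_power[OF that] .
  show ?thesis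
  proof (intro conjI allI impI)
    fix k :: nat assume k: "1 \<le> k"
    \<comment> \<open>Here the exponent of the symbolic power is 0, so the component is the whole
      ring.\<close>
    have below: "redundant (poly_ring n) {1..n} (\<lambda>j. sym_power n j (?b k j) :: 'k mpoly set) j"
      if "j < j'" for j
      by (rule redundant_sym_power_0[where m = "?b k"]) (use deg0[OF that] in simp)
    have symbolic: "sym_power_Min n I k = (sym_power n j' (k * ?l j') :: 'k mpoly set)"
    proof -
      let ?F = "{F. F \<subseteq> {1..n} \<and> card F = j'}"
      have primes: "minimal_primes (poly_ring n) I = (\<lambda>F. mono_span (deg_ge n F 1)) ` ?F"
        unfolding assms(4) Sss_eq[OF l]
        by (rule minimal_primes_card_bounded) (use deg0 deg_j' j' deg_on_prefix_mono in auto)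
      have loc: "loc_contraction n (mono_span (deg_ge n F 1)) (mono_span (card_bounded n (?b k)))
          = (mono_span (deg_ge n F (k * ?l j')) :: 'k mpoly set)" if F: "F \<in> ?F" for F
      proof -
        have "loc_contraction n (mono_span (deg_ge n F 1)) (mono_span (card_bounded n (?b k)))
          = (mono_span (deg_ge n F (?b k (card F))) :: 'k mpoly set)"
          by (rule loc_contraction_card_bounded) (use F deg0 b_mono in auto)
        then show ?thesis using F deg_j' by simp
      qed
      have "sym_power_Min n I k
          = ideal_Inter (poly_ring n) ((\<lambda>F. mono_span (deg_ge n F (k * ?l j')) :: 'k mpoly set) ` ?F)"
        unfolding sym_power_Min_def primes image_image pow[unfolded assms(1)]
        by (intro arg_cong[where f = "ideal_Inter (poly_ring n)"] image_cong refl loc)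
      also have "\<dots> = ideal_Inter (poly_ring n) (mono_span ` (\<lambda>F. deg_ge n F (k * ?l j')) ` ?F)"
        by (simp only: image_image)
      also have "\<dots> = sym_power n j' (k * ?l j')"
        unfolding ideal_Inter_mono_span sym_power_eq mono_span_inject by (auto simp: deg_ge_def)
      finally show ?thesis .
    qed
    have jump: "\<not> redundant (poly_ring n) {1..n} (\<lambda>j. sym_power n j (?b k j) :: 'k mpoly set) j"
      if "j \<in> {1..n}" "j' < j" "?l (j - 1) < ?l j" for j
      using that j' k by (intro c_red nonredundant_at_jump[OF l]) auto
    have iff: "\<not> redundant (poly_ring n) {1..n} (\<lambda>j. sym_power n j (?b k j) :: 'k mpoly set) j \<longleftrightarrow> j' \<le> j"
      if j: "j \<in> {1..n}" "?l 1 < ?l j" and cond: "k > j * (j - 1) \<or>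
             (\<exists>q r :: int. int (k * (\<Sum>i=1..j-1. ?l i)) = (int j - 1) * q + r \<and>
                0 \<le> r \<and> r \<le> int j - 2 \<and>
                real (?l j) > (real_of_int q + real j - real_of_int r) / real k)" for j
    proof (cases "j < j'")
      case True
      then show ?thesis using below by simp
    next
      case False
      have jn: "2 \<le> j" "j \<le> n" using two[OF j] j(1) by auto
      have "nonredundant_at n (?b k) j"
        using cond
      proof (elim disjE exE conjE)
        assume "j * (j - 1) < k"
        then show ?thesis by (rule nonredundant_at_large[OF l jn j(2)])
      next
        fix q r :: int
        assume "int (k * (\<Sum>i=1..j-1. ?l i)) = (int j - 1) * q + r" "0 \<le> r" "r \<le> int j - 2"
          "real (?l j) > (real_of_int q + real j - real_of_int r) / real k"
        then show ?thesis
          by (intro nonredundant_at_quotient[OF l jn _ _ _ k, of q r]) (simp_all only: deg_on_def)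
      qed
      then show ?thesis using c_red jn False by auto
    qed
    have decomposition: "ideal_pow (poly_ring n) I k
        = ideal_Inter (poly_ring n) ((\<lambda>j. sym_power n j (?b k j)) ` {1..n})"
      unfolding pow[unfolded assms(1)] by (rule card_bounded_eq_Inter) (simp add: deg_on_def)
    show "let c = (\<lambda>j. sym_power n j (k * a j)) :: nat \<Rightarrow> 'k mpoly set;
           redundant_comp = redundant R {1..n} c
       in
         ideal_pow R I k = ideal_Inter R (c ` {1..n}) \<and>
         (\<forall>j \<in> {1..n}. j < j' \<longrightarrow> redundant_comp j) \<and>
         (\<not> redundant_comp j' \<and>
            sym_power_Min n I k = sym_power n j' (k * Poly_Mapping.lookup l j')) \<and>
         (\<forall>j \<in> {1..n}. j > j' \<and> Poly_Mapping.lookup l (j - 1) < Poly_Mapping.lookup l j \<longrightarrow>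
            \<not> redundant_comp j) \<and>
         (\<forall>j \<in> {1..n}. Poly_Mapping.lookup l 1 < Poly_Mapping.lookup l j \<and>
            (k > j * (j - 1) \<or>
             (\<exists>q r :: int. int (k * (\<Sum>i=1..j-1. Poly_Mapping.lookup l i)) = (int j - 1) * q + r \<and>
                0 \<le> r \<and> r \<le> int j - 2 \<and>
                real (Poly_Mapping.lookup l j) > (real_of_int q + real j - real_of_int r) / real k))
            \<longrightarrow> (\<not> redundant_comp j \<longleftrightarrow> j \<ge> j')) \<and>
         (\<forall>j \<in> {1..n}. j > 1 \<and> Poly_Mapping.lookup l 1 = Poly_Mapping.lookup l j \<longrightarrow>
            redundant_comp j)"
      unfolding Let_def a assms(1)
    proof (intro conjI ballI impI, goal_cases)
      case 1
      show ?case by (rule decomposition)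
    next
      case (2 j)
      then show ?case by (intro below)
    next
      case 3
      show ?case by (rule c_red[OF first[OF k] j'(2)])
    next
      case 4
      show ?case by (rule symbolic)
    next
      case (5 j)
      then show ?case by (intro jump) simp_all
    next
      case (6 j)
      then show ?case by (elim conjE) (rule iff)
    next
      case (7 j)
      then show ?case by (intro redundant_sym_power_constant[OF l]) simp_all
    qed
  next
    have I_sub: "\<I> \<subseteq> {1..n}" using j' unfolding assms(8) by auto
    \<comment> \<open>\<open>n * n\<close> bounds \<open>j * (j - 1)\<close> for all
      \<open>j\<close> at once. The index \<open>j'\<close> is treated apart through its zero
      witness; the other indices satisfy \<open>l_1 < l_j\<close>.\<close>
    have J: "nonredundant_at n (?b k) j" if j: "j \<in> \<I>" and k: "n * n < k" for j k
    proof (cases "j = j'")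
      case True
      then show ?thesis using first k by simp
    next
      case False
      have jn: "j \<in> {1..n}" using I_sub j by blast
      have less: "?l 1 < ?l j"
      proof (cases "j' > 1")
        case True
        then have "j' < j" using j False unfolding assms(8) by auto
        then have "?l j' \<le> ?l j" using Pn_mono[OF l, of j' j] j' jn by simp
        then show ?thesis using l0[of 1] True j' by simp
      next
        case False
        then have "?l j \<noteq> ?l 1" using j \<open>j \<noteq> j'\<close> j' unfolding assms(8) by auto
        then show ?thesis using Pn_mono[OF l, of 1 j] jn by simp
      qed
      have "j * (j - 1) \<le> n * n" using jn by (intro mult_le_mono) auto
      then have "j * (j - 1) < k" using k by linarith
      with jn show ?thesis by (intro nonredundant_at_large[OF l two[OF jn less] _ less]) simp_all
    qed
    \<comment> \<open>A size missing from \<open>\<I>\<close> is either below \<open>j'\<close>,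
      with bound 0, or \<open>j' = 1\<close> and \<open>l\<close> is constant up to it; in the
      latter case 1 belongs to \<open>\<I>\<close> and the singleton bounds suffice.\<close>
    have cover: "u \<in> card_bounded n (?b k)"
      if u: "u \<in> expvecs n" "\<And>F. F \<subseteq> {1..n} \<Longrightarrow> card F \<in> \<I> \<Longrightarrow> ?b k (card F) \<le> deg_on F u" for u k
    proof -
      have "?b k (card F) \<le> deg_on F u" if F: "F \<subseteq> {1..n}" for F
      proof (cases "card F \<in> \<I> \<or> card F < j'")
        case True
        then show ?thesis using u(2)[OF F] deg0 by auto
      next
        case False
        have "card F \<in> {1..n}" using card_mono[OF _ F] False j' by simp
        then have "j' = 1" "?l 1 = ?l (card F)"
          using False j' unfolding assms(8) by (auto split: if_splits)
        moreover have "F \<noteq> {}" using False j' by auto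
        moreover have "?b k 1 \<le> deg_on {x} u" if "x \<in> F" for x
          using u(2)[of "{x}"] that F \<open>j' = 1\<close> unfolding assms(8) by auto
        ultimately show ?thesis by (intro constant_prefix_le_deg_on[OF l F]) auto
      qed
      then show ?thesis using u(1) by (simp add: card_bounded_def)
    qed
    have components: "{ideal_pow R (perm_poly \<sigma> ` P j) (k * a j) | j \<sigma>. j \<in> \<I> \<and> \<sigma> permutes {1..n}}
        = (\<lambda>F. mono_span (deg_ge n F (?b k (card F)))) ` {F. F \<subseteq> {1..n} \<and> card F \<in> \<I>}"
      (is "?A = ?q ` ?F") for k
    proof (intro equalityI subsetI)
      fix Q assume "Q \<in> ?A"
      then obtain j \<sigma> where j: "j \<in> \<I>" and \<sigma>: "\<sigma> permutes {1..n}"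
        and Q: "Q = ideal_pow R (perm_poly \<sigma> ` P j) (k * a j)" by blast
      have jn: "j \<le> n" using I_sub j by auto
      have card: "card (\<sigma> ` {1..j}) = j" by (simp add: card_image[OF permutes_inj_on[OF \<sigma>]])
      have "Q = ?q (\<sigma> ` {1..j})"
        unfolding Q assms(1) P a perm_prime_power[OF \<sigma> jn] card ..
      moreover have "\<sigma> ` {1..j} \<subseteq> {1..n}"
        using permutes_in_image[OF \<sigma>] jn by fastforce
      then have "\<sigma> ` {1..j} \<in> ?F" using j card by simp
      ultimately show "Q \<in> ?q ` ?F" by (rule image_eqI)
    next
      fix Q assume "Q \<in> ?q ` ?F"
      then obtain F where F: "Q = ?q F" "F \<in> ?F" by (rule imageE)
      then obtain \<sigma> where \<sigma>: "\<sigma> permutes {1..n}" "\<sigma> ` {1..card F} = F"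
        using exists_permutation_image[of F n] by blast
      have "card F \<le> n" using F I_sub by auto
      then have "Q = ideal_pow R (perm_poly \<sigma> ` P (card F)) (k * a (card F))"
        unfolding F(1) assms(1) P a by (simp only: perm_prime_power[OF \<sigma>(1)] \<sigma>(2))
      then show "Q \<in> ?A" using F(2) \<sigma>(1) by blast
    qed
    show "\<forall>\<^sub>F k in sequentially. minimal_primary_decomposition R (ideal_pow R I k)
        {ideal_pow R (perm_poly \<sigma> ` P j) (k * a j) | j \<sigma>. j \<in> \<I> \<and> \<sigma> permutes {1..n}}"
      using eventually_gt_at_top[of "n * n"]
    proof eventually_elim
      case (elim k)
      show ?case
        unfolding components pow unfolding assms(1)
        by (rule minimal_primary_decomposition_deg_ge[OF I_sub J[OF _ elim] cover])
    qed
  qed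
qed

end
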